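(* Let $D\subseteq R$ be commutative integral domains such that $R$ is countably generated over $D$ (as a ring) and $D$ has Krull dimension (in the sense of Gordon and Robson). If $D$ is weakly productively bounded, then the dual ideal lattice $L_R$ of $R$ is uniformly transversally bounded.
   Context: $R$ is countably generated over $D$ (as a ring) if there is a countable subset $S\subseteq R$ with $R=D[S]$, i.e. $R$ is countably generated as a $D$-algebra. Krull dimension: the deviation of a partially ordered set $P$ is defined by transfinite recursion: $\operatorname{dev}P=-\infty$ if $P$ is trivial (has no two distinct comparable elements); $\operatorname{dev}P=0$ if $P$ is nontrivial and satisfies the descending chain condition; and for an ordinal $\alpha>0$, $\operatorname{dev}P=\alpha$ if $\operatorname{dev}P\neq\beta$ for all $\beta<\alpha$ (and $P$ is nontrivial) and in every descending chain $a_1\ge a_2\ge\cdots$ in $P$ all but finitely many of the intervals $[a_{n+1},a_n]$ have deviation $<\alpha$. The ring $D$ has Krull dimension if the deviation of the poset of ideals of $D$ (ordered by inclusion) exists. A $D$-module $M$ is torsion if every element of $M$ is annihilated by some nonzero element of $D$; $\operatorname{ann}_D(M)=\{d\in D: dM=0\}$. $D$ is weakly productively bounded if, for every family $(M_i)_{i\in I}$ of $D$-modules such that $\prod_{i\in I}M_i$ is torsion, $\operatorname{ann}_D(M_i)\ne 0$ for all but finitely many $i\in I$. Let $L$ be a complete lattice with largest element $1$, such that $1$ is not the join of two strictly smaller elements. For a family $(X_i)_{i\in I}$ of nonempty subsets of $L$, a transversal of $(X_i)_{i\in I}$ is an element $(x_i)_{i\in I}\in\prod_{i\in I}X_i$;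 it is bounded if $\bigvee\{x_i: i\in I\}<1$. $L$ is uniformly transversally bounded if for each family $(X_i)_{i\in I}$ of nonempty subsets of $L$ all of whose transversals are bounded, there is a cofinite subset $J\subseteq I$ (i.e. $I\setminus J$ is finite) such that $\bigvee\big(\bigcup_{i\in J}X_i\big)<1$. $L_R$ denotes the lattice of ideals of $R$ ordered by reverse inclusion; thus joins in $L_R$ are intersections of ideals and the largest element $1$ of $L_R$ is the zero ideal. *)

theory Defs
  imports
    "HOL-Algebra.Complete_Lattice"
    "HOL-Algebra.Generated_Rings"
    "HOL-Algebra.Ideal_Product"
    "HOL-Algebra.Module"
    "HOL-Library.Countable_Set"
    "HOL-Library.FuncSet"
begin

section \<open>Countably generated ring extensions\<close>

definition countably_generated_over :: "('a, 'b) ring_scheme \<Rightarrow> 'a set \<Rightarrow> bool" where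
  "countably_generated_over R D \<longleftrightarrow>
     (\<exists>S. countable S \<and> S \<subseteq> carrier R \<and> carrier R = generate_ring R (D \<union> S))"


section \<open>Deviation and Krull dimension\<close>

definition trivial_order :: "'p gorder \<Rightarrow> bool" where
  "trivial_order P \<longleftrightarrow> (\<forall>x\<in>carrier P. \<forall>y\<in>carrier P. x \<sqsubseteq>\<^bsub>P\<^esub> y \<longrightarrow> x = y)"

definition descending_chain :: "'p gorder \<Rightarrow> (nat \<Rightarrow> 'p) \<Rightarrow> bool" where
  "descending_chain P a \<longleftrightarrow> (\<forall>n. a n \<in> carrier P) \<and> (\<forall>n. a (Suc n) \<sqsubseteq>\<^bsub>P\<^esub> a n)"

definition dcc :: "'p gorder \<Rightarrow> bool" where
  "dcc P \<longleftrightarrow> (\<forall>a. descending_chain P a \<longrightarrow> (\<exists>N. \<forall>n\<ge>N. a n = a N))"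

definition interval_order :: "'p gorder \<Rightarrow> 'p \<Rightarrow> 'p \<Rightarrow> 'p gorder" where
  "interval_order P x y = P\<lparr>carrier := \<lbrace>x..y\<rbrace>\<^bsub>P\<^esub>\<rparr>"

text \<open>
  Ordinals are represented by well-orders on a type \<open>'o\<close>, compared by \<open>ordLess\<close>; the ordinal 0 is the
  empty relation.  \<open>dev_eq \<alpha> P\<close> means \<open>dev P = \<alpha>\<close> for an ordinal \<open>\<alpha>\<close>, and \<open>dev P = -\<infinity>\<close> is
  \<open>trivial_order P\<close>.  Every ordinal below \<open>\<alpha>\<close> is again represented on \<open>'o\<close>, so the recursion
  does not depend on \<open>'o\<close>.
\<close>

declare conj_cong [fundef_cong]

function dev_eq :: "'o rel \<Rightarrow> 'p gorder \<Rightarrow> bool" where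
  "dev_eq \<alpha> P \<longleftrightarrow>
     Well_order \<alpha> \<and> \<not> trivial_order P \<and>
     (if \<alpha> = {} then dcc P
      else (\<forall>\<beta>. (\<beta>, \<alpha>) \<in> ordLess \<longrightarrow> \<not> dev_eq \<beta> P) \<and>
           (\<forall>a. descending_chain P a \<longrightarrow>
              finite {n. \<not> (trivial_order (interval_order P (a (Suc n)) (a n)) \<or>
                            (\<exists>\<beta>. (\<beta>, \<alpha>) \<in> ordLess \<and> dev_eq \<beta> (interval_order P (a (Suc n)) (a n))))}))"
  by pat_completeness auto
termination
  by (relation "inv_image ordLess fst") (auto intro: wf_ordLess wf_inv_image)

declare dev_eq.simps [simp del]

definition has_deviation :: "'o itself \<Rightarrow> 'p gorder \<Rightarrow> bool" where
  "has_deviation _ P \<longleftrightarrow> trivial_order P \<or> (\<exists>\<alpha>::'o rel. dev_eq \<alpha> P)"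

definition ideal_poset :: "('a, 'b) ring_scheme \<Rightarrow> 'a set gorder" where
  "ideal_poset R = \<lparr>carrier = {I. ideal I R}, eq = (=), le = (\<subseteq>)\<rparr>"

text \<open>
  The deviation exists iff \<open>has_deviation TYPE('o)\<close> holds for some \<open>'o\<close>.  Used as a hypothesis
  of a theorem with \<open>'o\<close> a free type variable, \<open>has_krull_dimension TYPE('o) D\<close> therefore puts no
  bound on the ordinal.
\<close>

definition has_krull_dimension :: "'o itself \<Rightarrow> ('a, 'b) ring_scheme \<Rightarrow> bool" where
  "has_krull_dimension T D \<longleftrightarrow> has_deviation T (ideal_poset D)"


section \<open>Weakly productively bounded rings\<close>

definition torsion_module :: "('a, 'b) ring_scheme \<Rightarrow> ('a, 'm) module \<Rightarrow> bool" where
  "torsion_module D M \<longleftrightarrow>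
     (\<forall>x\<in>carrier M. \<exists>d\<in>carrier D. d \<noteq> \<zero>\<^bsub>D\<^esub> \<and> d \<odot>\<^bsub>M\<^esub> x = \<zero>\<^bsub>M\<^esub>)"

definition module_ann :: "('a, 'b) ring_scheme \<Rightarrow> ('a, 'm) module \<Rightarrow> 'a set" where
  "module_ann D M = {d \<in> carrier D. \<forall>x\<in>carrier M. d \<odot>\<^bsub>M\<^esub> x = \<zero>\<^bsub>M\<^esub>}"

text \<open>The fields \<open>mult\<close> and \<open>one\<close> of a module record carry no meaning.\<close>

definition module_product :: "'i set \<Rightarrow> ('i \<Rightarrow> ('a, 'm) module) \<Rightarrow> ('a, 'i \<Rightarrow> 'm) module" where
  "module_product I M =
     \<lparr>carrier = (\<Pi>\<^sub>E i\<in>I. carrier (M i)),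
      mult = (\<lambda>x y. \<lambda>i\<in>I. x i \<otimes>\<^bsub>M i\<^esub> y i),
      one = (\<lambda>i\<in>I. \<one>\<^bsub>M i\<^esub>),
      zero = (\<lambda>i\<in>I. \<zero>\<^bsub>M i\<^esub>),
      add = (\<lambda>x y. \<lambda>i\<in>I. x i \<oplus>\<^bsub>M i\<^esub> y i),
      smult = (\<lambda>d x. \<lambda>i\<in>I. d \<odot>\<^bsub>M i\<^esub> x i)\<rparr>"

definition weakly_productively_bounded_on ::
  "'i itself \<Rightarrow> 'm itself \<Rightarrow> ('a, 'b) ring_scheme \<Rightarrow> bool" where
  "weakly_productively_bounded_on _ _ D \<longleftrightarrow>
     (\<forall>(I::'i set) (M::'i \<Rightarrow> ('a, 'm) module).
        (\<forall>i\<in>I. module D (M i)) \<longrightarrow> torsion_module D (module_product I M) \<longrightarrow>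
        finite {i\<in>I. module_ann D (M i) = {\<zero>\<^bsub>D\<^esub>}})"

text \<open>
  HOL cannot quantify over all index types and all module types inside a definition.  The two types
  chosen here are large enough: the property for them implies the property for all types, as
  \<open>weakly_productively_bounded_universe\<close> below shows.
\<close>

definition weakly_productively_bounded :: "('a, 'b) ring_scheme \<Rightarrow> bool" where
  "weakly_productively_bounded D \<longleftrightarrow>
     weakly_productively_bounded_on TYPE(nat) TYPE('a list) D"

lemma inj_concat_pairs: "inj (\<lambda>xs::('a \<times> 'a) list. concat (map (\<lambda>(c, d). [c, d]) xs))"
proof (rule injI)
  fix xs ys :: "('a \<times> 'a) list"
  assume "concat (map (\<lambda>(c, d). [c, d]) xs) = concat (map (\<lambda>(c, d). [c, d]) ys)"
  then show "xs = ys"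
  proof (induction xs arbitrary: ys)
    case Nil
    then show ?case by (cases ys) auto
  next
    case (Cons p xs)
    then show ?case by (cases ys) (auto split: prod.splits)
  qed
qed

lemma (in module) small_faithful_submodule:
  fixes w :: "'a \<Rightarrow> 'c"
  assumes w: "\<And>d. d \<in> carrier R \<Longrightarrow> w d \<in> carrier M"
  shows "\<exists>H (g::'c \<Rightarrow> 'a list). submodule H R M \<and> w ` carrier R \<subseteq> H \<and> inj_on g H"
proof -
  define ev where "ev = (\<lambda>xs. foldr (\<lambda>(c, d) s. c \<odot>\<^bsub>M\<^esub> w d \<oplus>\<^bsub>M\<^esub> s) xs \<zero>\<^bsub>M\<^esub>)"
  define A where "A = {xs. set xs \<subseteq> carrier R \<times> carrier R}"
  define H where "H = ev ` A"
  have ev_Nil [simp]: "ev [] = \<zero>\<^bsub>M\<^esub>"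
    and ev_Cons [simp]: "ev ((c, d) # xs) = c \<odot>\<^bsub>M\<^esub> w d \<oplus>\<^bsub>M\<^esub> ev xs" for c d xs
    by (simp_all add: ev_def)
  have ev_closed: "ev xs \<in> carrier M" if "xs \<in> A" for xs
    using that by (induction xs) (auto simp: A_def w)
  have ev_append: "ev (xs @ ys) = ev xs \<oplus>\<^bsub>M\<^esub> ev ys" if "xs \<in> A" "ys \<in> A" for xs ys
    using that(1)
  proof (induction xs)
    case Nil
    then show ?case using ev_closed[OF that(2)] by simp
  next
    case (Cons p xs)
    obtain c d where p: "p = (c, d)" by (cases p)
    have "c \<in> carrier R" "d \<in> carrier R" "xs \<in> A"
      using Cons.prems by (auto simp: A_def p)
    with Cons.IH show ?case
      using ev_closed that(2) w by (simp add: p M.a_assoc)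
  qed
  have ev_smult: "\<exists>ys\<in>A. ev ys = a \<odot>\<^bsub>M\<^esub> ev xs" if "a \<in> carrier R" "xs \<in> A" for a xs
    using that(2)
  proof (induction xs)
    case Nil
    show ?case using that(1) by (intro bexI[of _ "[]"]) (auto simp: A_def)
  next
    case (Cons p xs)
    obtain c d where p: "p = (c, d)" by (cases p)
    have *: "c \<in> carrier R" "d \<in> carrier R" "xs \<in> A"
      using Cons.prems by (auto simp: A_def p)
    from Cons.IH[OF *(3)] obtain ys where ys: "ys \<in> A" "ev ys = a \<odot>\<^bsub>M\<^esub> ev xs" by blast
    have "(a \<otimes> c, d) # ys \<in> A"
      using * ys(1) that(1) by (auto simp: A_def)
    moreover have "ev ((a \<otimes> c, d) # ys) = a \<odot>\<^bsub>M\<^esub> ev (p # xs)"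
      using * ys that(1) w ev_closed by (simp add: p smult_r_distr smult_assoc1)
    ultimately show ?case by blast
  qed
  have sub: "H \<subseteq> carrier M"
    using ev_closed by (auto simp: H_def)
  have smult: "a \<odot>\<^bsub>M\<^esub> x \<in> H" if "a \<in> carrier R" "x \<in> H" for a x
  proof -
    obtain xs where "xs \<in> A" "x = ev xs" using \<open>x \<in> H\<close> by (auto simp: H_def)
    then show ?thesis using ev_smult[OF that(1)] unfolding H_def by force
  qed
  have "submodule H R M"
  proof (rule submoduleI)
    show "\<zero>\<^bsub>M\<^esub> \<in> H"
      unfolding H_def by (rule image_eqI[of _ _ "[]"]) (auto simp: A_def)
    show "\<ominus>\<^bsub>M\<^esub> x \<in> H" if "x \<in> H" for x
    proof -
      have "\<ominus> \<one> \<odot>\<^bsub>M\<^esub> x = \<ominus>\<^bsub>M\<^esub> x"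
        using that sub smult_l_minus[of \<one> x] by auto
      then show ?thesis using smult[of "\<ominus> \<one>" x] that by simp
    qed
    show "x \<oplus>\<^bsub>M\<^esub> y \<in> H" if xy: "x \<in> H" "y \<in> H" for x y
    proof -
      obtain xs ys where "xs \<in> A" "ys \<in> A" "x = ev xs" "y = ev ys"
        using xy by (auto simp: H_def)
      then show ?thesis
        unfolding H_def by (intro image_eqI[of _ _ "xs @ ys"]) (auto simp: ev_append, auto simp: A_def)
    qed
  qed (use sub smult in auto)
  moreover have "w d \<in> H" if "d \<in> carrier R" for d
    unfolding H_def using that w
    by (intro image_eqI[of _ _ "[(\<one>, d)]"]) (auto simp: A_def)
  moreover have "inj_on ((\<lambda>xs. concat (map (\<lambda>(c, d). [c, d]) xs)) \<circ> inv_into A ev) H"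
    unfolding H_def
    using comp_inj_on[OF inj_on_inv_into[OF subset_refl] inj_on_subset[OF inj_concat_pairs subset_UNIV]] .
  ultimately show ?thesis by blast
qed

lemma (in module) transport_module:
  fixes g :: "'c \<Rightarrow> 'm"
  assumes H: "submodule H R M" and g: "inj_on g H"
  shows "\<exists>N::('a, 'm) module. \<exists>h. module R N \<and> bij_betw h (carrier N) H \<and> h \<zero>\<^bsub>N\<^esub> = \<zero>\<^bsub>M\<^esub> \<and>
           (\<forall>d\<in>carrier R. \<forall>x\<in>carrier N. h (d \<odot>\<^bsub>N\<^esub> x) = d \<odot>\<^bsub>M\<^esub> h x)"
proof -
  define h where "h = inv_into H g"
  define N :: "('a, 'm) module" where "N =
    \<lparr>carrier = g ` H, mult = undefined, one = undefined, zero = g \<zero>\<^bsub>M\<^esub>,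
     add = (\<lambda>x y. g (h x \<oplus>\<^bsub>M\<^esub> h y)), smult = (\<lambda>d x. g (d \<odot>\<^bsub>M\<^esub> h x))\<rparr>"
  have hg [simp]: "h (g x) = x" if "x \<in> H" for x
    using g that by (simp add: h_def)
  have HM: "x \<in> carrier M" if "x \<in> H" for x
    using submoduleE(1)[OF H] that by blast
  have add: "x \<oplus>\<^bsub>M\<^esub> y \<in> H" if "x \<in> H" "y \<in> H" for x y
    using submoduleE(5)[OF H] that by blast
  have smult: "a \<odot>\<^bsub>M\<^esub> x \<in> H" if "a \<in> carrier R" "x \<in> H" for a x
    using submoduleE(4)[OF H] that by blast
  have neg: "\<ominus>\<^bsub>M\<^esub> x \<in> H" if "x \<in> H" for x
    using submoduleE(3)[OF H] that by blast
  have zero: "\<zero>\<^bsub>M\<^esub> \<in> H"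
    using submoduleE(2)[OF H] add neg HM by (metis M.r_neg all_not_in_conv)
  have "abelian_group N"
  proof (rule abelian_groupI)
    fix x assume "x \<in> carrier N"
    then obtain u where u: "u \<in> H" "x = g u" by (auto simp: N_def)
    then show "\<exists>y\<in>carrier N. y \<oplus>\<^bsub>N\<^esub> x = \<zero>\<^bsub>N\<^esub>"
      by (intro bexI[of _ "g (\<ominus>\<^bsub>M\<^esub> u)"]) (auto simp: N_def neg HM M.l_neg)
  qed (auto simp: N_def add zero HM M.a_ac)
  then have "module R N"
    by (intro moduleI R.is_cring)
      (auto simp: N_def add smult HM smult_l_distr smult_r_distr smult_assoc1)
  moreover have "bij_betw h (carrier N) H"
    unfolding N_def h_def using g by (simp add: bij_betw_inv_into inj_on_imp_bij_betw)
  ultimately show ?thesis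
    by (intro exI[of _ N] exI[of _ h]) (auto simp: N_def zero smult)
qed

lemma small_faithful_module:
  fixes R :: "('a, 'b) ring_scheme" (structure) and M :: "('a, 'c) module"
  assumes "module R M" and ann: "module_ann R M = {\<zero>}"
  shows "\<exists>N::('a, 'a list) module. \<exists>h. module R N \<and> module_ann R N = {\<zero>} \<and>
           h \<in> carrier N \<rightarrow> carrier M \<and> inj_on h (carrier N) \<and> h \<zero>\<^bsub>N\<^esub> = \<zero>\<^bsub>M\<^esub> \<and>
           (\<forall>d\<in>carrier R. \<forall>x\<in>carrier N. h (d \<odot>\<^bsub>N\<^esub> x) = d \<odot>\<^bsub>M\<^esub> h x)"
proof -
  interpret module R M by fact
  have "\<forall>d\<in>carrier R. \<exists>x\<in>carrier M. d \<noteq> \<zero> \<longrightarrow> d \<odot>\<^bsub>M\<^esub> x \<noteq> \<zero>\<^bsub>M\<^esub>"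
    using ann M.zero_closed unfolding module_ann_def by blast
  then obtain w where w: "\<And>d. d \<in> carrier R \<Longrightarrow> w d \<in> carrier M"
      "\<And>d. d \<in> carrier R \<Longrightarrow> d \<noteq> \<zero> \<Longrightarrow> d \<odot>\<^bsub>M\<^esub> w d \<noteq> \<zero>\<^bsub>M\<^esub>"
    by metis
  obtain H and g :: "'c \<Rightarrow> 'a list"
    where H: "submodule H R M" "w ` carrier R \<subseteq> H" "inj_on g H"
    using small_faithful_submodule[of w] w(1) by blast
  obtain N :: "('a, 'a list) module" and h where N: "module R N" "bij_betw h (carrier N) H"
      "h \<zero>\<^bsub>N\<^esub> = \<zero>\<^bsub>M\<^esub>" "\<forall>d\<in>carrier R. \<forall>x\<in>carrier N. h (d \<odot>\<^bsub>N\<^esub> x) = d \<odot>\<^bsub>M\<^esub> h x"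
    using transport_module[OF H(1,3)] by blast
  interpret N: module R N by (rule N(1))
  have "d = \<zero>" if d: "d \<in> module_ann R N" for d
  proof (rule ccontr)
    assume nz: "d \<noteq> \<zero>"
    have dR: "d \<in> carrier R" using d by (simp add: module_ann_def)
    then obtain x where x: "x \<in> carrier N" "h x = w d"
      using H(2) N(2) by (metis bij_betw_imp_surj_on imageE image_subset_iff)
    have "d \<odot>\<^bsub>M\<^esub> w d = h (d \<odot>\<^bsub>N\<^esub> x)" using N(4) x dR by simp
    also have "\<dots> = \<zero>\<^bsub>M\<^esub>" using d x N(3) by (simp add: module_ann_def)
    finally show False using w(2)[OF dR nz] by simp
  qed
  moreover have "\<zero> \<in> module_ann R N"
    by (simp add: module_ann_def)
  ultimately have "module_ann R N = {\<zero>}" by blast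
  moreover have "h \<in> carrier N \<rightarrow> carrier M"
    using N(2) submoduleE(1)[OF H(1)] by (auto dest: bij_betwE)
  ultimately show ?thesis
    using N by (intro exI[of _ N] exI[of _ h]) (auto dest: bij_betw_imp_inj_on)
qed

theorem weakly_productively_bounded_universe:
  fixes D :: "('a, 'b) ring_scheme"
  assumes "weakly_productively_bounded D"
  shows "weakly_productively_bounded_on TYPE('i) TYPE('m) D"
  unfolding weakly_productively_bounded_on_def
proof (intro allI impI)
  fix I :: "'i set" and M :: "'i \<Rightarrow> ('a, 'm) module"
  assume M: "\<forall>i\<in>I. module D (M i)" and tor: "torsion_module D (module_product I M)"
  define F where "F = {i\<in>I. module_ann D (M i) = {\<zero>\<^bsub>D\<^esub>}}"
  have "finite F"
  proof (rule ccontr)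
    assume "infinite F"
    then obtain f :: "nat \<Rightarrow> 'i" where f: "inj f" "range f \<subseteq> F"
      using infinite_countable_subset by blast
    then have fI: "f n \<in> I" for n by (auto simp: F_def)
    have "\<forall>n. \<exists>N::('a, 'a list) module. \<exists>h. module D N \<and> module_ann D N = {\<zero>\<^bsub>D\<^esub>} \<and>
        h \<in> carrier N \<rightarrow> carrier (M (f n)) \<and> inj_on h (carrier N) \<and> h \<zero>\<^bsub>N\<^esub> = \<zero>\<^bsub>M (f n)\<^esub> \<and>
        (\<forall>d\<in>carrier D. \<forall>x\<in>carrier N. h (d \<odot>\<^bsub>N\<^esub> x) = d \<odot>\<^bsub>M (f n)\<^esub> h x)"
      using f(2) M by (intro allI small_faithful_module) (auto simp: F_def)
    then obtain N :: "nat \<Rightarrow> ('a, 'a list) module" and h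
      where N: "\<And>n. module D (N n)" "\<And>n. module_ann D (N n) = {\<zero>\<^bsub>D\<^esub>}"
        and h: "\<And>n. h n \<in> carrier (N n) \<rightarrow> carrier (M (f n))" "\<And>n. inj_on (h n) (carrier (N n))"
          "\<And>n. h n \<zero>\<^bsub>N n\<^esub> = \<zero>\<^bsub>M (f n)\<^esub>"
          "\<And>n d x. d \<in> carrier D \<Longrightarrow> x \<in> carrier (N n) \<Longrightarrow>
             h n (d \<odot>\<^bsub>N n\<^esub> x) = d \<odot>\<^bsub>M (f n)\<^esub> h n x"
      by metis
    have "torsion_module D (module_product UNIV N)"
      unfolding torsion_module_def
    proof
      fix x assume "x \<in> carrier (module_product UNIV N)"
      then have x: "x n \<in> carrier (N n)" for n
        by (auto simp: module_product_def)
      define y where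
        "y = (\<lambda>i\<in>I. if i \<in> range f then h (inv_into UNIV f i) (x (inv_into UNIV f i)) else \<zero>\<^bsub>M i\<^esub>)"
      have yf: "y (f n) = h n (x n)" for n
        using f(1) fI by (simp add: y_def)
      have zeroM: "\<zero>\<^bsub>M i\<^esub> \<in> carrier (M i)" if "i \<in> I" for i
        using M that by (meson abelian_group.axioms(1) abelian_monoid.zero_closed module.axioms(2))
      have "y i \<in> carrier (M i)" if "i \<in> I" for i
      proof (cases "i \<in> range f")
        case True
        then show ?thesis using yf h(1) x by (auto simp: Pi_iff)
      next
        case False
        then show ?thesis using that zeroM by (simp add: y_def)
      qed
      then have "y \<in> carrier (module_product I M)"
        by (auto simp: module_product_def y_def)
      then obtain d where d: "d \<in> carrier D" "d \<noteq> \<zero>\<^bsub>D\<^esub>"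
          "d \<odot>\<^bsub>module_product I M\<^esub> y = \<zero>\<^bsub>module_product I M\<^esub>"
        using tor unfolding torsion_module_def by blast
      have "d \<odot>\<^bsub>N n\<^esub> x n = \<zero>\<^bsub>N n\<^esub>" for n
      proof -
        interpret Nn: module D "N n" by (rule N(1))
        have "d \<odot>\<^bsub>M (f n)\<^esub> y (f n) = \<zero>\<^bsub>M (f n)\<^esub>"
          using fun_cong[OF d(3), of "f n"] fI by (simp add: module_product_def)
        then have "h n (d \<odot>\<^bsub>N n\<^esub> x n) = h n \<zero>\<^bsub>N n\<^esub>"
          using h(3,4) d(1) x by (simp add: yf)
        then show ?thesis
          using h(2)[of n] d(1) x by (auto dest: inj_onD)
      qed
      then show "\<exists>d\<in>carrier D. d \<noteq> \<zero>\<^bsub>D\<^esub> \<and>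
          d \<odot>\<^bsub>module_product UNIV N\<^esub> x = \<zero>\<^bsub>module_product UNIV N\<^esub>"
        using d(1,2) by (auto simp: module_product_def)
    qed
    then have "finite {n\<in>UNIV. module_ann D (N n) = {\<zero>\<^bsub>D\<^esub>}}"
      using assms N(1)
      unfolding weakly_productively_bounded_def weakly_productively_bounded_on_def by blast
    then show False using N(2) by simp
  qed
  then show "finite {i\<in>I. module_ann D (M i) = {\<zero>\<^bsub>D\<^esub>}}"
    by (simp add: F_def)
qed


section \<open>Uniformly transversally bounded lattices\<close>

text \<open>
  Only meaningful for a complete lattice \<open>L\<close> whose top element is not the join of two strictly
  smaller elements; \<open>domain.dual_ideal_lattice_top_join\<close> below supplies this for ideal lattices.
\<close>

definition uniformly_transversally_bounded :: "'i itself \<Rightarrow> ('p, 'c) gorder_scheme \<Rightarrow> bool" where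
  "uniformly_transversally_bounded _ L \<longleftrightarrow>
     (\<forall>(I::'i set) X.
        (\<forall>i\<in>I. X i \<subseteq> carrier L \<and> X i \<noteq> {}) \<longrightarrow>
        (\<forall>x\<in>(\<Pi>\<^sub>E i\<in>I. X i). \<Squnion>\<^bsub>L\<^esub>(x ` I) \<sqsubset>\<^bsub>L\<^esub> \<top>\<^bsub>L\<^esub>) \<longrightarrow>
        (\<exists>J\<subseteq>I. finite (I - J) \<and> \<Squnion>\<^bsub>L\<^esub>(\<Union>i\<in>J. X i) \<sqsubset>\<^bsub>L\<^esub> \<top>\<^bsub>L\<^esub>))"

definition dual_ideal_lattice :: "('a, 'b) ring_scheme \<Rightarrow> 'a set gorder" where
  "dual_ideal_lattice R = inv_gorder (ideal_poset R)"

lemma dual_ideal_lattice_simps [simp]: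
  "carrier (dual_ideal_lattice R) = {I. ideal I R}"
  "I \<sqsubseteq>\<^bsub>dual_ideal_lattice R\<^esub> J \<longleftrightarrow> J \<subseteq> I"
  "I .=\<^bsub>dual_ideal_lattice R\<^esub> J \<longleftrightarrow> I = J"
  "I \<sqsubset>\<^bsub>dual_ideal_lattice R\<^esub> J \<longleftrightarrow> J \<subset> I"
  by (auto simp: dual_ideal_lattice_def ideal_poset_def lless_def)

lemma partial_order_dual_ideal_lattice: "partial_order (dual_ideal_lattice R)"
  by standard (auto simp: dual_ideal_lattice_def ideal_poset_def)

context ring
begin

lemma least_dual_ideal_lattice:
  assumes "A \<subseteq> carrier (dual_ideal_lattice R)"
  shows "least (dual_ideal_lattice R) (carrier R \<inter> \<Inter>A) (Upper (dual_ideal_lattice R) A)"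
proof -
  have "ideal (\<Inter>(insert (carrier R) A)) R"
    using assms by (intro i_Intersect) (auto simp: oneideal)
  then show ?thesis
    using assms by (intro least_UpperI) (auto simp: Upper_def dest: ideal.Icarr)
qed

lemma complete_lattice_dual_ideal_lattice: "complete_lattice (dual_ideal_lattice R)"
proof (rule partial_order.complete_latticeI[OF partial_order_dual_ideal_lattice])
  fix A assume A: "A \<subseteq> carrier (dual_ideal_lattice R)"
  then show "\<exists>s. least (dual_ideal_lattice R) s (Upper (dual_ideal_lattice R) A)"
    using least_dual_ideal_lattice by blast
  have U: "\<Union>A \<subseteq> carrier R" using A by (auto dest: ideal.Icarr)
  have "greatest (dual_ideal_lattice R) (genideal R (\<Union>A)) (Lower (dual_ideal_lattice R) A)"
  proof (rule greatest_LowerI)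
    fix J assume "J \<in> Lower (dual_ideal_lattice R) A"
    then have "ideal J R" "\<Union>A \<subseteq> J" using A by (auto simp: Lower_def)
    then show "J \<sqsubseteq>\<^bsub>dual_ideal_lattice R\<^esub> genideal R (\<Union>A)"
      using genideal_minimal by auto
  qed (use A genideal_ideal[OF U] genideal_self[OF U] in auto)
  then show "\<exists>i. greatest (dual_ideal_lattice R) i (Lower (dual_ideal_lattice R) A)" ..
qed

lemma sup_dual_ideal_lattice:
  assumes "A \<subseteq> carrier (dual_ideal_lattice R)"
  shows "\<Squnion>\<^bsub>dual_ideal_lattice R\<^esub>A = carrier R \<inter> \<Inter>A"
proof -
  interpret L: complete_lattice "dual_ideal_lattice R"
    by (rule complete_lattice_dual_ideal_lattice)
  show ?thesis
    using L.supI[of A "\<lambda>l. l = carrier R \<inter> \<Inter>A"] assms least_dual_ideal_lattice[OF assms]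
      L.least_unique by blast
qed

lemma top_dual_ideal_lattice: "\<top>\<^bsub>dual_ideal_lattice R\<^esub> = {\<zero>}"
proof -
  interpret L: complete_lattice "dual_ideal_lattice R"
    by (rule complete_lattice_dual_ideal_lattice)
  have "{\<zero>} \<subseteq> \<top>\<^bsub>dual_ideal_lattice R\<^esub>"
    using L.top_closed by (auto dest: additive_subgroup.zero_closed ideal.axioms(1))
  moreover have "\<top>\<^bsub>dual_ideal_lattice R\<^esub> \<subseteq> {\<zero>}"
    using L.top_higher[of "{\<zero>}"] zeroideal by simp
  ultimately show ?thesis by blast
qed

end

lemma (in domain) dual_ideal_lattice_top_join:
  assumes "I \<in> carrier (dual_ideal_lattice R)" "I \<sqsubset>\<^bsub>dual_ideal_lattice R\<^esub> \<top>\<^bsub>dual_ideal_lattice R\<^esub>"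
    and "J \<in> carrier (dual_ideal_lattice R)" "J \<sqsubset>\<^bsub>dual_ideal_lattice R\<^esub> \<top>\<^bsub>dual_ideal_lattice R\<^esub>"
  shows "I \<squnion>\<^bsub>dual_ideal_lattice R\<^esub> J \<noteq> \<top>\<^bsub>dual_ideal_lattice R\<^esub>"
proof -
  have I: "ideal I R" and J: "ideal J R" using assms by simp_all
  obtain a b where ab: "a \<in> I" "a \<noteq> \<zero>" "b \<in> J" "b \<noteq> \<zero>"
    using assms by (auto simp: top_dual_ideal_lattice)
  then have carr: "a \<in> carrier R" "b \<in> carrier R"
    using I J by (auto dest: ideal.Icarr)
  then have "a \<otimes> b \<in> I \<inter> J"
    using ab I J by (auto intro: ideal.I_r_closed ideal.I_l_closed)
  moreover have "a \<otimes> b \<noteq> \<zero>"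
    using ab carr integral by blast
  moreover have "a \<otimes> b \<in> carrier R" using carr by simp
  ultimately show ?thesis
    using sup_dual_ideal_lattice[of "{I, J}"] I J by (auto simp: join_def top_dual_ideal_lattice)
qed

end

theory Submission
  imports Defs
begin

text \<open>
  Suppose no cofinite subfamily of the family \<open>X\<close> of sets of ideals has nonzero intersection; a
  transversal with zero intersection has to be found.

  Krull dimension forbids infinite irredundant intersections of ideals of \<open>D\<close>, since these would
  produce a dense chain. Hence every sequence of ideals of \<open>D\<close> has a finite part \<open>F\<close> and a
  subsequence \<open>S\<close> such that an element of all members of \<open>F\<close> that lies in infinitely many members of
  \<open>S\<close> lies in all of them. Fix \<open>z \<noteq> 0\<close> in \<open>R\<close>;
  if members of \<open>X\<close> at infinitely many indices meet \<open>D z\<close> in zero, they separate it. Otherwise, for each \<open>c \<noteq> 0\<close> in \<open>D\<close> choose members \<open>A\<^sub>n\<close> of \<open>X\<close> at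
  distinct indices with \<open>z c p\<^sub>n \<notin> A\<^sub>n\<close>, where \<open>p\<^sub>n\<close> is a product of nonzero elements of \<open>D\<close> with
  \<open>z p\<^sub>n \<in> A\<^sub>k\<close> for \<open>k < n\<close>. A suitable subsequence then comes with an ideal \<open>Q\<close> of \<open>D\<close> not containing \<open>c\<close>
  such that \<open>d \<in> Q\<close> whenever \<open>z d\<close> lies in infinitely many of the chosen \<open>A\<^sub>n\<close>. These ideals \<open>Q\<close>
  intersect in zero, and weak productive boundedness, applied to countably many copies of a product
  of the modules \<open>D/Q\<close>, leaves countably many of them with zero intersection. So \<open>D z\<close> meets
  the intersection of countably many partial transversals in zero, and this persists when each of
  them is thinned out to an infinite part. Adding one generator at a time, the same holds for finitely
  generated \<open>D\<close>-submodules of \<open>R\<close>, and so for their countable union \<open>R\<close>. Countably many infinite partial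
  transversals can be thinned out to have disjoint supports, and then they fit into one transversal.
\<close>

section \<open>Deviation and infinite irredundant intersections\<close>

text \<open>Induction on \<alpha> with \<open>P\<close>, \<open>a\<close>, \<open>b\<close> general
  and \<open>f\<close> fixed. A decreasing sequence of rationals gives a strictly descending chain,
  which breaks the DCC if \<alpha> is zero. Otherwise some interval of the chain is trivial or has
  smaller deviation; but it contains the image of a whole rational segment, so it is not trivial and
  the induction hypothesis applies to it.\<close>

lemma no_deviation_if_dense_chain:
  fixes f :: "rat \<Rightarrow> 'p" and \<alpha> :: "'o rel"
  assumes "dev_eq \<alpha> P" and "a < b"
    and "\<And>x. a \<le> x \<Longrightarrow> x \<le> b \<Longrightarrow> f x \<in> carrier P"
    and "\<And>x y. a \<le> x \<Longrightarrow> x \<le> y \<Longrightarrow> y \<le> b \<Longrightarrow> f x \<sqsubseteq>\<^bsub>P\<^esub> f y"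
    and "\<And>x y. a \<le> x \<Longrightarrow> x < y \<Longrightarrow> y \<le> b \<Longrightarrow> f x \<noteq> f y"
  shows False
  using assms
proof (induction \<alpha> arbitrary: P a b rule: wf_induct_rule[OF wf_ordLess])
  case (1 \<alpha>)
  note dev = "1.prems"(1) and ab = "1.prems"(2) and closed = "1.prems"(3)
    and mono = "1.prems"(4) and strict = "1.prems"(5)
  \<comment> \<open>Any strictly decreasing sequence in the segment would do; this one starts at
    \<open>b\<close> and tends to \<open>a\<close>.\<close>
  define s where "s = (\<lambda>n::nat. a + (b - a) / of_nat (Suc n))"
  have s_le: "s n \<le> b" and s_ge: "a \<le> s n" and s_less: "s (Suc n) < s n" for n
  proof -
    show "s n \<le> b"
    proof -
      have "(b - a) / of_nat (Suc n) \<le> (b - a) / 1"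
        using ab by (intro divide_left_mono) auto
      then show ?thesis by (simp add: s_def)
    qed
    show "a \<le> s n" using ab by (simp add: s_def)
    show "s (Suc n) < s n"
      unfolding s_def using ab by (intro add_strict_left_mono divide_strict_left_mono) auto
  qed
  define c where "c = (\<lambda>n. f (s n))"
  have chain: "descending_chain P c"
    unfolding descending_chain_def c_def
    using closed mono s_le s_ge s_less by (simp add: less_imp_le)
  have c_neq: "c (Suc n) \<noteq> c n" for n
    unfolding c_def using strict s_le s_ge s_less by blast
  have not_trivial: "\<not> trivial_order Q"
    if "p < q" "f p \<in> carrier Q" "f q \<in> carrier Q" "f p \<sqsubseteq>\<^bsub>Q\<^esub> f q" "f p \<noteq> f q" for p q Q
    using that unfolding trivial_order_def by blast
  show False
  proof (cases "\<alpha> = {}")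
    case True
    then have "dcc P" using dev by (simp add: dev_eq.simps[of "{}" P])
    then show False using chain c_neq unfolding dcc_def by (metis le_refl le_SucI)
  next
    case False
    let ?I = "\<lambda>n. interval_order P (c (Suc n)) (c n)"
    have "finite {n. \<not> (trivial_order (?I n) \<or> (\<exists>\<beta>::'o rel. (\<beta>, \<alpha>) \<in> ordLess \<and> dev_eq \<beta> (?I n)))}"
      using dev[unfolded dev_eq.simps[of \<alpha> P]] False chain by (simp only: if_False simp_thms)
    from ex_new_if_finite[OF infinite_UNIV_nat this] obtain n
      where n: "trivial_order (?I n) \<or> (\<exists>\<beta>::'o rel. (\<beta>, \<alpha>) \<in> ordLess \<and> dev_eq \<beta> (?I n))"
      by blast
    have in_I: "f x \<in> carrier (?I n)" if "s (Suc n) \<le> x" "x \<le> s n" for x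
    proof -
      have "a \<le> x" "x \<le> b" using that s_ge s_le order_trans by blast+
      then show ?thesis
        using that closed mono s_ge s_le
        by (simp add: interval_order_def at_least_at_most_def c_def)
    qed
    have I_le: "f x \<sqsubseteq>\<^bsub>?I n\<^esub> f y" if "s (Suc n) \<le> x" "x \<le> y" "y \<le> s n" for x y
      using mono[of x y] that s_ge[of "Suc n"] s_le[of n] by (simp add: interval_order_def)
    have I_neq: "f x \<noteq> f y" if "s (Suc n) \<le> x" "x < y" "y \<le> s n" for x y
      using strict[of x y] that s_ge[of "Suc n"] s_le[of n] by simp
    have "\<not> trivial_order (?I n)"
      using not_trivial[OF s_less[of n]] in_I I_le I_neq s_less[of n] by (meson less_imp_le order_refl)
    then obtain \<beta> :: "'o rel" where "(\<beta>, \<alpha>) \<in> ordLess" "dev_eq \<beta> (?I n)" using n by blast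
    then show False
      using "1.IH" s_less[of n] in_I I_le I_neq by blast
  qed
qed

text \<open>
  Over a countable dense set of indices the partial intersections would form a dense chain of ideals.
\<close>

lemma (in ring) krull_dimension_no_irredundant_sequence:
  fixes A :: "nat \<Rightarrow> 'a set" and d :: "nat \<Rightarrow> 'a"
  assumes "has_krull_dimension TYPE('o) R"
    and A: "\<And>n. ideal (A n) R" and d: "\<And>n. d n \<in> carrier R"
    and irr: "\<And>n j. d n \<in> A j \<longleftrightarrow> j \<noteq> n"
  shows False
proof -
  define f where "f = (\<lambda>r::rat. \<Inter>(insert (carrier R) ((A \<circ> to_nat) ` {q. r < q})))"
  have closed: "f r \<in> carrier (ideal_poset R)" for r
  proof -
    have "ideal (f r) R"
      unfolding f_def using A by (intro i_Intersect) (auto simp: oneideal)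
    then show ?thesis by (simp add: ideal_poset_def)
  qed
  have mono: "f r \<sqsubseteq>\<^bsub>ideal_poset R\<^esub> f r'" if "r \<le> r'" for r r'
    unfolding f_def ideal_poset_def using that by auto
  have strict: "f r \<noteq> f r'" if "r < r'" for r r'
  proof -
    \<comment> \<open>\<open>A (to_nat r')\<close> is the only ideal that misses this element. It
      takes part in \<open>f r\<close> because \<open>r < r'\<close>, but not in
      \<open>f r'\<close>, where the rational index must exceed \<open>r'\<close>.\<close>
    have "d (to_nat r') \<in> f r'" "d (to_nat r') \<notin> f r"
      using that d irr by (auto simp: f_def)
    then show ?thesis by blast
  qed
  show False
  proof (cases "trivial_order (ideal_poset R)")
    case True
    then show False using closed mono[of 0 1] strict[of 0 1] unfolding trivial_order_def by auto
  next
    case False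
    then obtain \<alpha> :: "'o rel" where "dev_eq \<alpha> (ideal_poset R)"
      using assms(1) unfolding has_krull_dimension_def has_deviation_def by blast
    then show False
      using no_deviation_if_dense_chain[of \<alpha> _ 0 1 f] closed mono strict by auto
  qed
qed

text \<open>If every choice of \<open>F\<close> and \<open>S\<close> fails, the failures can be
  iterated: each gives \<open>i\<close> in \<open>S\<close> and \<open>x\<close> outside
  \<open>B i\<close> that lies in \<open>B j\<close> for all \<open>j\<close> in \<open>F\<close>
  and for infinitely many \<open>j\<close> in \<open>S\<close>. Add \<open>i\<close> to
  \<open>F\<close>, shrink \<open>S\<close> to those \<open>j\<close>, and repeat. The pairs
  obtained contradict \<open>krull_dimension_no_irredundant_sequence\<close>.\<close>

lemma (in ring) krull_dimension_stable_subsequence: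
  assumes krull: "has_krull_dimension TYPE('o) R" and B: "\<And>n::nat. ideal (B n) R"
  shows "\<exists>F S. finite F \<and> infinite S \<and>
    (\<forall>x\<in>carrier R. (\<forall>j\<in>F. x \<in> B j) \<longrightarrow> infinite {j\<in>S. x \<in> B j} \<longrightarrow> (\<forall>j\<in>S. x \<in> B j))"
proof (rule ccontr)
  assume contra: "\<not> ?thesis"
  have step: "\<exists>i x S'. i \<in> S \<and> x \<in> carrier R \<and> x \<notin> B i \<and> (\<forall>j\<in>F. x \<in> B j) \<and>
      S' \<subseteq> S \<and> infinite S' \<and> (\<forall>j\<in>S'. x \<in> B j)" if "finite F" "infinite S" for F S
  proof -
    have "\<not> (\<forall>x\<in>carrier R. (\<forall>j\<in>F. x \<in> B j) \<longrightarrow> infinite {j\<in>S. x \<in> B j} \<longrightarrow> (\<forall>j\<in>S. x \<in> B j))"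
      using contra that by (intro notI) (erule notE, intro exI conjI)
    then obtain x i where "x \<in> carrier R" "\<forall>j\<in>F. x \<in> B j" "infinite {j\<in>S. x \<in> B j}" "i \<in> S" "x \<notin> B i"
      by blast
    then show ?thesis
      by (intro exI[of _ i] exI[of _ x] exI[of _ "{j\<in>S. x \<in> B j}"]) auto
  qed
  \<comment> \<open>In a state, \<open>F\<close> holds the indices chosen so far, \<open>S\<close>
    those still available, and \<open>i\<close>, \<open>x\<close> are the latest pair.\<close>
  define P where "P = (\<lambda>(F, S, i, x). finite F \<and> infinite S \<and> x \<in> carrier R \<and> i \<in> F \<and>
    x \<notin> B i \<and> (\<forall>j\<in>S. x \<in> B j))"
  define Q where "Q = (\<lambda>(F, S, i :: nat, x :: 'a) (F', S', i' :: nat, x' :: 'a). F' = insert i' F \<and> S' \<subseteq> S \<and> i' \<in> S \<and>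
    (\<forall>j\<in>F. x' \<in> B j))"
  have "\<exists>s. \<forall>n. P (s n) \<and> Q (s n) (s (Suc n))"
  proof (rule dependent_nat_choice)
    obtain i x S where "x \<in> carrier R" "x \<notin> B i" "infinite (S :: nat set)" "\<forall>j\<in>S. x \<in> B j"
      using step[of "{}" UNIV] by auto
    then have "P ({i}, S, i, x)" by (simp add: P_def)
    then show "\<exists>s. P s" ..
  next
    fix s assume Ps: "P s"
    obtain F S i x where s: "s = (F, S, i, x)" by (cases s)
    have "finite F" "infinite S" using Ps by (auto simp: s P_def)
    from step[OF this] obtain i' x' S' where
      "i' \<in> S" "x' \<in> carrier R" "x' \<notin> B i'" "\<forall>j\<in>F. x' \<in> B j" "S' \<subseteq> S" "infinite S'" "\<forall>j\<in>S'. x' \<in> B j"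
      by blast
    then have "P (insert i' F, S', i', x') \<and> Q s (insert i' F, S', i', x')"
      using \<open>finite F\<close> by (simp add: P_def Q_def s)
    then show "\<exists>s'. P s' \<and> Q s s'" ..
  qed
  then obtain s where s: "\<And>n. P (s n)" "\<And>n. Q (s n) (s (Suc n))" by blast
  define F where "F = (\<lambda>n. fst (s n))"
  define S where "S = (\<lambda>n. fst (snd (s n)))"
  define i where "i = (\<lambda>n. fst (snd (snd (s n))))"
  define x where "x = (\<lambda>n. snd (snd (snd (s n))))"
  have s_eq: "s n = (F n, S n, i n, x n)" for n by (simp add: F_def S_def i_def x_def)
  have xR: "x n \<in> carrier R" and iF: "i n \<in> F n" and x_notin: "x n \<notin> B (i n)"
    and x_S: "j \<in> S n \<Longrightarrow> x n \<in> B j" for n j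
    using s(1)[of n] by (auto simp: P_def s_eq)
  have F_Suc: "F n \<subseteq> F (Suc n)" and S_Suc: "S (Suc n) \<subseteq> S n" and i_Suc: "i (Suc n) \<in> S n"
    and x_F: "j \<in> F n \<Longrightarrow> x (Suc n) \<in> B j" for n j
    using s(2)[of n] by (auto simp: Q_def s_eq)
  \<comment> \<open>An earlier index \<open>i j\<close> already belonged to \<open>F\<close> when
    \<open>x n\<close> was chosen; a later one is drawn from \<open>S n\<close>, all of whose ideals
    contain \<open>x n\<close>.\<close>
  have "x n \<in> B (i j)" if "j < n" for n j
  proof -
    obtain m where m: "n = Suc m" "j \<le> m" using \<open>j < n\<close> by (cases n) auto
    have "F j \<subseteq> F m" using F_Suc m(2) by (rule lift_Suc_mono_le)
    then show ?thesis using iF x_F m(1) by blast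
  qed
  moreover have "x n \<in> B (i j)" if "n < j" for n j
  proof -
    obtain m where m: "j = Suc m" "n \<le> m" using \<open>n < j\<close> by (cases j) auto
    have "S m \<subseteq> S n" using S_Suc m(2) by (rule lift_Suc_antimono_le)
    then show ?thesis using i_Suc x_S m(1) by blast
  qed
  ultimately have "x n \<in> B (i j) \<longleftrightarrow> j \<noteq> n" for n j
    using x_notin by (metis linorder_neqE_nat)
  then show False
    using krull_dimension_no_irredundant_sequence[OF krull, of "\<lambda>n. B (i n)" x] B xR by blast
qed

section \<open>Countable subfamilies of ideals from weak productive boundedness\<close>

text \<open>The part of the product of the cyclic modules \<open>R/Q\<close> formed by the elements
  of countable support: a sequence of its elements involves only countably many \<open>Q\<close>,
  yet every single coordinate is still available.\<close>

definition countable_support_product ::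
    "('a, 'b) ring_scheme \<Rightarrow> 'a set set \<Rightarrow> ('a, 'a set \<Rightarrow> 'a set) module" where
  "countable_support_product R \<Q> =
     \<lparr>carrier = {f \<in> \<Pi>\<^sub>E Q\<in>\<Q>. carrier (R Quot Q). countable {Q\<in>\<Q>. f Q \<noteq> \<zero>\<^bsub>R Quot Q\<^esub>}},
      mult = undefined, one = undefined,
      zero = (\<lambda>Q\<in>\<Q>. \<zero>\<^bsub>R Quot Q\<^esub>),
      add = (\<lambda>f g. \<lambda>Q\<in>\<Q>. f Q \<oplus>\<^bsub>R Quot Q\<^esub> g Q),
      smult = (\<lambda>d f. \<lambda>Q\<in>\<Q>. (Q +>\<^bsub>R\<^esub> d) \<otimes>\<^bsub>R Quot Q\<^esub> f Q)\<rparr>"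

text \<open>All axioms are checked coordinate by coordinate in the quotient rings. Supports stay
  countable because each operation yields zero wherever its arguments are zero.\<close>

lemma (in cring) module_countable_support_product:
  assumes "\<And>Q. Q \<in> \<Q> \<Longrightarrow> ideal Q R"
  shows "module R (countable_support_product R \<Q>)" (is "module R ?M")
proof -
  have hom: "ring_hom_ring R (R Quot Q) ((+>) Q)" if "Q \<in> \<Q>" for Q
    using assms[OF that] by (rule ideal.rcos_ring_hom_ring)
  have quot:
    "\<zero>\<^bsub>R Quot Q\<^esub> \<in> carrier (R Quot Q)"
    "\<zero>\<^bsub>R Quot Q\<^esub> \<oplus>\<^bsub>R Quot Q\<^esub> \<zero>\<^bsub>R Quot Q\<^esub> = \<zero>\<^bsub>R Quot Q\<^esub>"
    "\<ominus>\<^bsub>R Quot Q\<^esub> \<zero>\<^bsub>R Quot Q\<^esub> = \<zero>\<^bsub>R Quot Q\<^esub>" if "Q \<in> \<Q>" for Q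
  proof -
    interpret ring_hom_ring R "R Quot Q" "(+>) Q" using hom[OF that(1)] .
    show "\<zero>\<^bsub>R Quot Q\<^esub> \<in> carrier (R Quot Q)"
      "\<zero>\<^bsub>R Quot Q\<^esub> \<oplus>\<^bsub>R Quot Q\<^esub> \<zero>\<^bsub>R Quot Q\<^esub> = \<zero>\<^bsub>R Quot Q\<^esub>"
      "\<ominus>\<^bsub>R Quot Q\<^esub> \<zero>\<^bsub>R Quot Q\<^esub> = \<zero>\<^bsub>R Quot Q\<^esub>"
      by simp_all
  qed
  have support: "countable {Q\<in>\<Q>. h Q \<noteq> \<zero>\<^bsub>R Quot Q\<^esub>}"
    if "f \<in> carrier ?M" "g \<in> carrier ?M"
      "\<And>Q. Q \<in> \<Q> \<Longrightarrow> f Q = \<zero>\<^bsub>R Quot Q\<^esub> \<Longrightarrow> g Q = \<zero>\<^bsub>R Quot Q\<^esub> \<Longrightarrow> h Q = \<zero>\<^bsub>R Quot Q\<^esub>" for f g h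
  proof (rule countable_subset)
    show "{Q\<in>\<Q>. h Q \<noteq> \<zero>\<^bsub>R Quot Q\<^esub>} \<subseteq>
        {Q\<in>\<Q>. f Q \<noteq> \<zero>\<^bsub>R Quot Q\<^esub>} \<union> {Q\<in>\<Q>. g Q \<noteq> \<zero>\<^bsub>R Quot Q\<^esub>}"
      using that(3) by blast
  qed (use that in \<open>simp_all add: countable_support_product_def\<close>)
  have mem: "f Q \<in> carrier (R Quot Q)" if "f \<in> carrier ?M" "Q \<in> \<Q>" for f Q
    using that by (auto simp: countable_support_product_def)
  \<comment> \<open>Stated for two arguments; negation and scalar multiplication use it with the
    same element twice.\<close>
  have closedI: "h \<in> carrier ?M"
    if "f \<in> carrier ?M" "g \<in> carrier ?M" "h \<in> extensional \<Q>"
      "\<And>Q. Q \<in> \<Q> \<Longrightarrow> h Q \<in> carrier (R Quot Q)"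
      "\<And>Q. Q \<in> \<Q> \<Longrightarrow> f Q = \<zero>\<^bsub>R Quot Q\<^esub> \<Longrightarrow> g Q = \<zero>\<^bsub>R Quot Q\<^esub> \<Longrightarrow> h Q = \<zero>\<^bsub>R Quot Q\<^esub>" for f g h
  proof -
    have "h \<in> (\<Pi>\<^sub>E Q\<in>\<Q>. carrier (R Quot Q))"
      using that(4) by (intro PiE_I extensional_arb[OF that(3)])
    moreover have "countable {Q\<in>\<Q>. h Q \<noteq> \<zero>\<^bsub>R Quot Q\<^esub>}"
      by (rule support[OF that(1,2)]) (rule that(5))
    ultimately show ?thesis by (simp add: countable_support_product_def)
  qed
  have eqI: "f = g" if "f \<in> carrier ?M" "g \<in> carrier ?M" "\<And>Q. Q \<in> \<Q> \<Longrightarrow> f Q = g Q" for f g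
    using that by (intro extensionalityI[of f \<Q>]) (auto simp: countable_support_product_def PiE_def)
  have zero: "\<zero>\<^bsub>?M\<^esub> \<in> carrier ?M"
    using quot(1) by (auto simp: countable_support_product_def cong: conj_cong)
  have add: "f \<oplus>\<^bsub>?M\<^esub> g \<in> carrier ?M" if "f \<in> carrier ?M" "g \<in> carrier ?M" for f g
  proof (rule closedI[OF that])
    fix Q assume Q: "Q \<in> \<Q>"
    interpret ring_hom_ring R "R Quot Q" "(+>) Q" using hom[OF Q] .
    show "(f \<oplus>\<^bsub>?M\<^esub> g) Q \<in> carrier (R Quot Q)"
      using mem[OF that(1) Q] mem[OF that(2) Q] Q by (simp add: countable_support_product_def)
  qed (simp_all add: countable_support_product_def quot)
  have smult: "d \<odot>\<^bsub>?M\<^esub> f \<in> carrier ?M" if "d \<in> carrier R" "f \<in> carrier ?M" for d f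
  proof (rule closedI[OF that(2) that(2)])
    fix Q assume Q: "Q \<in> \<Q>"
    interpret ring_hom_ring R "R Quot Q" "(+>) Q" using hom[OF Q] .
    show "(d \<odot>\<^bsub>?M\<^esub> f) Q \<in> carrier (R Quot Q)"
      using mem[OF that(2) Q] that(1) Q by (simp add: countable_support_product_def)
    show "(d \<odot>\<^bsub>?M\<^esub> f) Q = \<zero>\<^bsub>R Quot Q\<^esub>" if "f Q = \<zero>\<^bsub>R Quot Q\<^esub>"
      using that \<open>d \<in> carrier R\<close> Q by (simp add: countable_support_product_def)
  qed (simp add: countable_support_product_def)
  have zero_app: "\<zero>\<^bsub>?M\<^esub> Q = \<zero>\<^bsub>R Quot Q\<^esub>"
    and add_app: "(f \<oplus>\<^bsub>?M\<^esub> g) Q = f Q \<oplus>\<^bsub>R Quot Q\<^esub> g Q"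
    and smult_app: "(d \<odot>\<^bsub>?M\<^esub> f) Q = (Q +> d) \<otimes>\<^bsub>R Quot Q\<^esub> f Q" if "Q \<in> \<Q>" for Q f g d
    using that by (simp_all add: countable_support_product_def)
  note app = zero_app add_app smult_app
  have "abelian_group ?M"
  proof (rule abelian_groupI)
    fix f g h assume f: "f \<in> carrier ?M" and g: "g \<in> carrier ?M" and h: "h \<in> carrier ?M"
    show "f \<oplus>\<^bsub>?M\<^esub> g \<oplus>\<^bsub>?M\<^esub> h = f \<oplus>\<^bsub>?M\<^esub> (g \<oplus>\<^bsub>?M\<^esub> h)"
    proof (intro eqI add f g h)
      fix Q assume Q: "Q \<in> \<Q>"
      interpret ring_hom_ring R "R Quot Q" "(+>) Q" using hom[OF Q] .
      show "(f \<oplus>\<^bsub>?M\<^esub> g \<oplus>\<^bsub>?M\<^esub> h) Q = (f \<oplus>\<^bsub>?M\<^esub> (g \<oplus>\<^bsub>?M\<^esub> h)) Q"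
        using mem[OF _ Q] f g h Q by (simp add: app S.a_assoc)
    qed
  next
    fix f g assume f: "f \<in> carrier ?M" and g: "g \<in> carrier ?M"
    show "f \<oplus>\<^bsub>?M\<^esub> g = g \<oplus>\<^bsub>?M\<^esub> f"
    proof (intro eqI add f g)
      fix Q assume Q: "Q \<in> \<Q>"
      interpret ring_hom_ring R "R Quot Q" "(+>) Q" using hom[OF Q] .
      show "(f \<oplus>\<^bsub>?M\<^esub> g) Q = (g \<oplus>\<^bsub>?M\<^esub> f) Q"
        using mem[OF _ Q] f g Q by (simp add: app S.a_comm)
    qed
  next
    fix f assume f: "f \<in> carrier ?M"
    show "\<zero>\<^bsub>?M\<^esub> \<oplus>\<^bsub>?M\<^esub> f = f"
    proof (intro eqI add f zero)
      fix Q assume Q: "Q \<in> \<Q>"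
      interpret ring_hom_ring R "R Quot Q" "(+>) Q" using hom[OF Q] .
      show "(\<zero>\<^bsub>?M\<^esub> \<oplus>\<^bsub>?M\<^esub> f) Q = f Q"
        using mem[OF f Q] Q by (simp add: app)
    qed
    define g where "g = (\<lambda>Q\<in>\<Q>. \<ominus>\<^bsub>R Quot Q\<^esub> f Q)"
    have g: "g \<in> carrier ?M"
    proof (rule closedI[OF f f])
      fix Q assume Q: "Q \<in> \<Q>"
      interpret ring_hom_ring R "R Quot Q" "(+>) Q" using hom[OF Q] .
      show "g Q \<in> carrier (R Quot Q)"
        using mem[OF f Q] Q by (simp add: g_def)
    qed (simp_all add: g_def quot)
    have "g \<oplus>\<^bsub>?M\<^esub> f = \<zero>\<^bsub>?M\<^esub>"
    proof (intro eqI add f g zero)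
      fix Q assume Q: "Q \<in> \<Q>"
      interpret ring_hom_ring R "R Quot Q" "(+>) Q" using hom[OF Q] .
      show "(g \<oplus>\<^bsub>?M\<^esub> f) Q = \<zero>\<^bsub>?M\<^esub> Q"
        using mem[OF f Q] Q by (simp add: app g_def S.l_neg)
    qed
    then show "\<exists>y\<in>carrier ?M. y \<oplus>\<^bsub>?M\<^esub> f = \<zero>\<^bsub>?M\<^esub>" using g by blast
  qed (use zero add in blast)+
  then show ?thesis
  proof (rule moduleI[OF is_cring])
    fix a b f g assume a: "a \<in> carrier R" and b: "b \<in> carrier R"
      and f: "f \<in> carrier ?M" and g: "g \<in> carrier ?M"
    show "(a \<oplus> b) \<odot>\<^bsub>?M\<^esub> f = a \<odot>\<^bsub>?M\<^esub> f \<oplus>\<^bsub>?M\<^esub> b \<odot>\<^bsub>?M\<^esub> f"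
    proof (intro eqI add smult a_closed a b f)
      fix Q assume Q: "Q \<in> \<Q>"
      interpret ring_hom_ring R "R Quot Q" "(+>) Q" using hom[OF Q] .
      show "((a \<oplus> b) \<odot>\<^bsub>?M\<^esub> f) Q = (a \<odot>\<^bsub>?M\<^esub> f \<oplus>\<^bsub>?M\<^esub> b \<odot>\<^bsub>?M\<^esub> f) Q"
        using a b mem[OF f Q] Q by (simp add: app S.l_distr)
    qed
    show "a \<odot>\<^bsub>?M\<^esub> (f \<oplus>\<^bsub>?M\<^esub> g) = a \<odot>\<^bsub>?M\<^esub> f \<oplus>\<^bsub>?M\<^esub> a \<odot>\<^bsub>?M\<^esub> g"
    proof (intro eqI add smult a f g)
      fix Q assume Q: "Q \<in> \<Q>"
      interpret ring_hom_ring R "R Quot Q" "(+>) Q" using hom[OF Q] .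
      show "(a \<odot>\<^bsub>?M\<^esub> (f \<oplus>\<^bsub>?M\<^esub> g)) Q = (a \<odot>\<^bsub>?M\<^esub> f \<oplus>\<^bsub>?M\<^esub> a \<odot>\<^bsub>?M\<^esub> g) Q"
        using a mem[OF f Q] mem[OF g Q] Q by (simp add: app S.r_distr)
    qed
    show "(a \<otimes> b) \<odot>\<^bsub>?M\<^esub> f = a \<odot>\<^bsub>?M\<^esub> (b \<odot>\<^bsub>?M\<^esub> f)"
    proof (intro eqI smult m_closed a b f)
      fix Q assume Q: "Q \<in> \<Q>"
      interpret ring_hom_ring R "R Quot Q" "(+>) Q" using hom[OF Q] .
      show "((a \<otimes> b) \<odot>\<^bsub>?M\<^esub> f) Q = (a \<odot>\<^bsub>?M\<^esub> (b \<odot>\<^bsub>?M\<^esub> f)) Q"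
        using a b mem[OF f Q] Q by (simp add: app S.m_assoc)
    qed
  next
    fix f assume f: "f \<in> carrier ?M"
    show "\<one> \<odot>\<^bsub>?M\<^esub> f = f"
    proof (intro eqI smult f one_closed)
      fix Q assume Q: "Q \<in> \<Q>"
      interpret ring_hom_ring R "R Quot Q" "(+>) Q" using hom[OF Q] .
      show "(\<one> \<odot>\<^bsub>?M\<^esub> f) Q = f Q"
        using mem[OF f Q] Q by (simp add: app)
    qed
  qed (rule smult)
qed

text \<open>The module \<open>?M\<close> is faithful since the ideals intersect in zero. Hence its
  power over \<open>nat\<close> is not torsion and has an element \<open>x\<close> that no nonzero
  scalar kills. The supports of the \<open>x n\<close> together form a countable set of ideals, and
  a scalar in all of these would kill every \<open>x n\<close>.\<close>

lemma (in cring) weakly_productively_bounded_countable_subfamily: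
  assumes wpb: "weakly_productively_bounded R"
    and ideals: "\<And>Q. Q \<in> \<Q> \<Longrightarrow> ideal Q R"
    and zero: "\<And>d. d \<in> carrier R \<Longrightarrow> d \<noteq> \<zero> \<Longrightarrow> \<exists>Q\<in>\<Q>. d \<notin> Q"
  shows "\<exists>\<C>\<subseteq>\<Q>. countable \<C> \<and> (\<forall>d\<in>carrier R. d \<noteq> \<zero> \<longrightarrow> (\<exists>Q\<in>\<C>. d \<notin> Q))"
proof -
  let ?M = "countable_support_product R \<Q>"
  interpret M: module R ?M by (rule module_countable_support_product[OF ideals])
  have coset: "Q +> d = \<zero>\<^bsub>R Quot Q\<^esub> \<longleftrightarrow> d \<in> Q" if "Q \<in> \<Q>" "d \<in> carrier R" for Q d
    using ideal.rcos_const_imp_mem[OF ideals[OF that(1)] that(2)] ideals[OF that(1)] that(2)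
    by (auto simp: FactRing_def abelian_subgroup.a_rcos_const[OF abelian_subgroupI3]
        ideal.axioms(1) abelian_group_axioms)
  have "module_ann R ?M = {\<zero>}"
  proof -
    have "d = \<zero>" if "d \<in> module_ann R ?M" for d
    proof (rule ccontr)
      assume "d \<noteq> \<zero>"
      have d: "d \<in> carrier R" using that by (simp add: module_ann_def)
      then obtain Q where Q: "Q \<in> \<Q>" "d \<notin> Q" using zero \<open>d \<noteq> \<zero>\<close> by blast
      \<comment> \<open>The unit of \<open>R/Q\<close> placed at the coordinate \<open>Q\<close>;
        \<open>d\<close> sends it to the coset of \<open>d\<close>, which is nonzero because
        \<open>d\<close> is not in \<open>Q\<close>.\<close>
      define f where "f = (\<lambda>P\<in>\<Q>. if P = Q then \<one>\<^bsub>R Quot P\<^esub> else \<zero>\<^bsub>R Quot P\<^esub>)"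
      have ring: "ring (R Quot P)" if "P \<in> \<Q>" for P
        using ideals[OF that] by (rule ideal.quotient_is_ring)
      have "{P\<in>\<Q>. f P \<noteq> \<zero>\<^bsub>R Quot P\<^esub>} \<subseteq> {Q}" by (auto simp: f_def)
      then have "countable {P\<in>\<Q>. f P \<noteq> \<zero>\<^bsub>R Quot P\<^esub>}"
        by (rule countable_subset) simp
      moreover have "f \<in> (\<Pi>\<^sub>E P\<in>\<Q>. carrier (R Quot P))"
        using abelian_monoid.zero_closed[OF abelian_group.axioms(1)[OF ring.is_abelian_group[OF ring]]]
          monoid.one_closed[OF ring.is_monoid[OF ring]]
        by (simp add: f_def PiE_iff)
      ultimately have "f \<in> carrier ?M" by (simp add: countable_support_product_def)
      then have "(d \<odot>\<^bsub>?M\<^esub> f) Q = \<zero>\<^bsub>?M\<^esub> Q"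
        using that by (simp add: module_ann_def)
      then have "(Q +> d) \<otimes>\<^bsub>R Quot Q\<^esub> \<one>\<^bsub>R Quot Q\<^esub> = \<zero>\<^bsub>R Quot Q\<^esub>"
        using Q(1) by (simp add: countable_support_product_def f_def)
      moreover have "Q +> d \<in> carrier (R Quot Q)"
        using ideal.rcos_ring_hom[OF ideals[OF Q(1)]] d by (rule ring_hom_closed)
      ultimately show False
        using coset[OF Q(1) d] Q(2) ring[OF Q(1)] by (simp add: ring.is_monoid monoid.r_one)
    qed
    then show ?thesis by (auto simp: module_ann_def)
  qed
  \<comment> \<open>Each of the infinitely many copies of \<open>?M\<close> has zero annihilator,
    which weak productive boundedness excludes for a torsion product.\<close>
  then have "\<not> torsion_module R (module_product (UNIV :: nat set) (\<lambda>_. ?M))"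
    using weakly_productively_bounded_universe[OF wpb, where 'i = nat and 'm = "'a set \<Rightarrow> 'a set"]
      M.module_axioms
    unfolding weakly_productively_bounded_on_def by fastforce
  then obtain x where x: "x \<in> carrier (module_product (UNIV :: nat set) (\<lambda>_. ?M))"
      and torsion_free: "\<And>d. d \<in> carrier R \<Longrightarrow> d \<noteq> \<zero> \<Longrightarrow>
        d \<odot>\<^bsub>module_product UNIV (\<lambda>_. ?M)\<^esub> x \<noteq> \<zero>\<^bsub>module_product UNIV (\<lambda>_. ?M)\<^esub>"
    unfolding torsion_module_def by blast
  have xM: "x n \<in> carrier ?M" for n
    using x by (auto simp: module_product_def)
  have not_killed: "\<exists>n. d \<odot>\<^bsub>?M\<^esub> x n \<noteq> \<zero>\<^bsub>?M\<^esub>" if "d \<in> carrier R" "d \<noteq> \<zero>" for d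
    using torsion_free[OF that] by (auto simp: module_product_def)
  define \<C> where "\<C> = (\<Union>n. {Q\<in>\<Q>. x n Q \<noteq> \<zero>\<^bsub>R Quot Q\<^esub>})"
  have "\<exists>Q\<in>\<C>. d \<notin> Q" if d: "d \<in> carrier R" "d \<noteq> \<zero>" for d
  proof (rule ccontr)
    assume none: "\<not> (\<exists>Q\<in>\<C>. d \<notin> Q)"
    obtain n where n: "d \<odot>\<^bsub>?M\<^esub> x n \<noteq> \<zero>\<^bsub>?M\<^esub>" using not_killed d by blast
    \<comment> \<open>Off the support of \<open>x n\<close> the coordinate is zero already; on it
      \<open>Q\<close> belongs to \<C>, so \<open>none\<close> puts \<open>d\<close> into
      \<open>Q\<close>.\<close>
    have "(Q +> d) \<otimes>\<^bsub>R Quot Q\<^esub> x n Q = \<zero>\<^bsub>R Quot Q\<^esub>" if Q: "Q \<in> \<Q>" for Q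
    proof -
      interpret Quot: ring "R Quot Q" using ideals[OF Q] by (rule ideal.quotient_is_ring)
      have c: "Q +> d \<in> carrier (R Quot Q)" "x n Q \<in> carrier (R Quot Q)"
        using ideal.rcos_ring_hom[OF ideals[OF Q]] d(1) xM[of n] Q
        by (auto simp: countable_support_product_def intro: ring_hom_closed)
      show ?thesis
      proof (cases "x n Q = \<zero>\<^bsub>R Quot Q\<^esub>")
        case True
        then show ?thesis using c by simp
      next
        case False
        then have "d \<in> Q" using none Q by (auto simp: \<C>_def)
        then show ?thesis using coset[OF Q d(1)] c(2) by simp
      qed
    qed
    then have "d \<odot>\<^bsub>?M\<^esub> x n = \<zero>\<^bsub>?M\<^esub>"
      by (simp add: countable_support_product_def cong: restrict_cong)
    then show False using n by blast
  qed
  moreover have "countable \<C>"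
    unfolding \<C>_def using xM by (intro countable_UN) (auto simp: countable_support_product_def)
  moreover have "\<C> \<subseteq> \<Q>" by (auto simp: \<C>_def)
  ultimately show ?thesis by blast
qed

section \<open>Partial transversals and separation\<close>

text \<open>The graph of a choice function on an infinite set of indices, kept as a set of pairs so
  that thinning out is passing to a subset.\<close>

definition partial_transversal :: "'i set \<Rightarrow> ('i \<Rightarrow> 'b set) \<Rightarrow> ('i \<times> 'b) set \<Rightarrow> bool" where
  "partial_transversal I X \<tau> \<longleftrightarrow> infinite \<tau> \<and> inj_on fst \<tau> \<and> \<tau> \<subseteq> Sigma I X"

lemma partial_transversal_subset:
  "partial_transversal I X \<tau> \<Longrightarrow> \<sigma> \<subseteq> \<tau> \<Longrightarrow> infinite \<sigma> \<Longrightarrow> partial_transversal I X \<sigma>"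
  unfolding partial_transversal_def by (meson inj_on_subset subset_trans)

text \<open>
  Allowing arbitrary infinite subsets makes it possible to pass to pairwise disjoint supports later.
\<close>

definition separates :: "('a, 'b) ring_scheme \<Rightarrow> ('i \<times> 'a set) set set \<Rightarrow> 'a set \<Rightarrow> bool" where
  "separates R T N \<longleftrightarrow>
     (\<forall>K. (\<forall>\<tau>\<in>T. K \<tau> \<subseteq> \<tau> \<and> infinite (K \<tau>)) \<longrightarrow>
        (\<forall>x\<in>N. (\<forall>\<tau>\<in>T. \<forall>(i, A)\<in>K \<tau>. x \<in> A) \<longrightarrow> x = \<zero>\<^bsub>R\<^esub>))"

lemma separatesD:
  assumes "separates R T N" "\<And>\<tau>. \<tau> \<in> T \<Longrightarrow> K \<tau> \<subseteq> \<tau>" "\<And>\<tau>. \<tau> \<in> T \<Longrightarrow> infinite (K \<tau>)"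
    "x \<in> N" "\<And>\<tau> i A. \<tau> \<in> T \<Longrightarrow> (i, A) \<in> K \<tau> \<Longrightarrow> x \<in> A"
  shows "x = \<zero>\<^bsub>R\<^esub>"
proof -
  have "\<forall>\<tau>\<in>T. K \<tau> \<subseteq> \<tau> \<and> infinite (K \<tau>)" "\<forall>\<tau>\<in>T. \<forall>(i, A)\<in>K \<tau>. x \<in> A"
    using assms by auto
  then show ?thesis using assms(1,4) unfolding separates_def by simp
qed

lemma separatesI:
  assumes "\<And>K x. (\<And>\<tau>. \<tau> \<in> T \<Longrightarrow> K \<tau> \<subseteq> \<tau>) \<Longrightarrow> (\<And>\<tau>. \<tau> \<in> T \<Longrightarrow> infinite (K \<tau>)) \<Longrightarrow> x \<in> N \<Longrightarrow>
    (\<And>\<tau> i A. \<tau> \<in> T \<Longrightarrow> (i, A) \<in> K \<tau> \<Longrightarrow> x \<in> A) \<Longrightarrow> x = \<zero>\<^bsub>R\<^esub>"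
  shows "separates R T N"
  unfolding separates_def
proof (intro allI impI ballI)
  fix K x assume K: "\<forall>\<tau>\<in>T. K \<tau> \<subseteq> \<tau> \<and> infinite (K \<tau>)" and x: "x \<in> N"
    and mem: "\<forall>\<tau>\<in>T. \<forall>(i, A)\<in>K \<tau>. x \<in> A"
  show "x = \<zero>\<^bsub>R\<^esub>"
  proof (rule assms[of K x])
    show "K \<tau> \<subseteq> \<tau>" "infinite (K \<tau>)" if "\<tau> \<in> T" for \<tau> using K that by auto
    show "x \<in> A" if "\<tau> \<in> T" "(i, A) \<in> K \<tau>" for \<tau> i A using mem that by fastforce
  qed (rule x)
qed

definition countably_separated ::
    "('a, 'b) ring_scheme \<Rightarrow> 'i set \<Rightarrow> ('i \<Rightarrow> 'a set set) \<Rightarrow> 'a set \<Rightarrow> bool" where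
  "countably_separated R I X N \<longleftrightarrow>
     (\<exists>T. countable T \<and> (\<forall>\<tau>\<in>T. partial_transversal I X \<tau>) \<and> separates R T N)"

lemma countably_separated_subset:
  assumes "countably_separated R I X N'" "N \<subseteq> N'"
  shows "countably_separated R I X N"
proof -
  obtain T where T: "countable T" "\<forall>\<tau>\<in>T. partial_transversal I X \<tau>" "separates R T N'"
    using assms(1) unfolding countably_separated_def by blast
  have "separates R T N"
  proof (rule separatesI)
    fix K x
    assume K: "\<And>\<tau>. \<tau> \<in> T \<Longrightarrow> K \<tau> \<subseteq> \<tau>" "\<And>\<tau>. \<tau> \<in> T \<Longrightarrow> infinite (K \<tau>)"
      and x: "x \<in> N" "\<And>\<tau> i A. \<tau> \<in> T \<Longrightarrow> (i, A) \<in> K \<tau> \<Longrightarrow> x \<in> A"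
    show "x = \<zero>\<^bsub>R\<^esub>"
      by (rule separatesD[OF T(3), of K]) (use K x assms(2) in blast)+
  qed
  then show ?thesis using T(1,2) unfolding countably_separated_def by blast
qed

text \<open>The separating families can be pooled, because a thinning \<open>K\<close> of the pool
  is in particular a thinning of each \<open>T N\<close>.\<close>

lemma countably_separated_UN:
  assumes "countable \<N>" "\<And>N. N \<in> \<N> \<Longrightarrow> countably_separated R I X N"
  shows "countably_separated R I X (\<Union>\<N>)"
proof -
  have "\<forall>N\<in>\<N>. \<exists>T. countable T \<and> (\<forall>\<tau>\<in>T. partial_transversal I X \<tau>) \<and> separates R T N"
    using assms(2) by (simp add: countably_separated_def)
  then obtain T where T: "\<And>N. N \<in> \<N> \<Longrightarrow> countable (T N)"
      "\<And>N \<tau>. N \<in> \<N> \<Longrightarrow> \<tau> \<in> T N \<Longrightarrow> partial_transversal I X \<tau>"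
      "\<And>N. N \<in> \<N> \<Longrightarrow> separates R (T N) N"
    by metis
  have "separates R (\<Union>(T ` \<N>)) (\<Union>\<N>)"
  proof (rule separatesI)
    fix K x
    assume K: "\<And>\<tau>. \<tau> \<in> \<Union>(T ` \<N>) \<Longrightarrow> K \<tau> \<subseteq> \<tau>" "\<And>\<tau>. \<tau> \<in> \<Union>(T ` \<N>) \<Longrightarrow> infinite (K \<tau>)"
      and x: "x \<in> \<Union>\<N>" "\<And>\<tau> i A. \<tau> \<in> \<Union>(T ` \<N>) \<Longrightarrow> (i, A) \<in> K \<tau> \<Longrightarrow> x \<in> A"
    from x(1) obtain N where N: "N \<in> \<N>" "x \<in> N" by blast
    have UN: "\<tau> \<in> \<Union>(T ` \<N>)" if "\<tau> \<in> T N" for \<tau> using N(1) that by blast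
    show "x = \<zero>\<^bsub>R\<^esub>"
    proof (rule separatesD[OF T(3)[OF N(1)], of K])
      show "K \<tau> \<subseteq> \<tau>" "infinite (K \<tau>)" if "\<tau> \<in> T N" for \<tau>
        using K UN[OF that] by simp_all
      show "x \<in> A" if "\<tau> \<in> T N" "(i, A) \<in> K \<tau>" for \<tau> i A
        using UN[OF that(1)] that(2) by (rule x(2))
    qed (rule N(2))
  qed
  then show ?thesis
    unfolding countably_separated_def using T assms(1)
    by (intro exI[of _ "\<Union>(T ` \<N>)"]) auto
qed

section \<open>Separating cyclic \<open>D\<close>-submodules\<close>

text \<open>This is the contraction to \<open>D\<close> of the colon ideal of the intersection of
  \<A> by \<open>u\<close>. It serves for single ideals with \<open>u = z\<close> and for a whole
  subsequence with \<open>u = z \<otimes> p n\<close>.\<close>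

lemma (in cring) subcring_colon_ideal:
  assumes D: "subcring D R" and \<A>: "\<And>A. A \<in> \<A> \<Longrightarrow> ideal A R" and u: "u \<in> carrier R"
  shows "ideal {x \<in> D. \<forall>A\<in>\<A>. u \<otimes> x \<in> A} (R\<lparr>carrier := D\<rparr>)"
proof -
  note sub = subcringE[OF D]
  have DR: "x \<in> carrier R" if "x \<in> D" for x using sub(1) that by blast
  interpret D: ring "R\<lparr>carrier := D\<rparr>"
    using D by (intro subring_is_ring) (simp add: subcring_def)
  have A: "\<zero> \<in> A" "x \<in> A \<Longrightarrow> y \<in> A \<Longrightarrow> x \<oplus> y \<in> A" "x \<in> A \<Longrightarrow> \<ominus> x \<in> A"
      "x \<in> A \<Longrightarrow> r \<in> carrier R \<Longrightarrow> r \<otimes> x \<in> A" if "A \<in> \<A>" for A x y r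
  proof -
    interpret ideal A R using \<A>[OF that] .
    show "\<zero> \<in> A" "x \<in> A \<Longrightarrow> y \<in> A \<Longrightarrow> x \<oplus> y \<in> A" "x \<in> A \<Longrightarrow> \<ominus> x \<in> A"
      "x \<in> A \<Longrightarrow> r \<in> carrier R \<Longrightarrow> r \<otimes> x \<in> A"
      by (simp_all add: I_l_closed)
  qed
  \<comment> \<open>\<open>subgroup\<close> refers to inverses in the additive monoid of the
    subring; uniqueness of inverses identifies them with those of \<open>R\<close>.\<close>
  have inv: "inv\<^bsub>add_monoid (R\<lparr>carrier := D\<rparr>)\<^esub> x = \<ominus> x" if "x \<in> D" for x
  proof -
    have "\<ominus>\<^bsub>R\<lparr>carrier := D\<rparr>\<^esub> x = \<ominus> x"
      using that DR sub(4,5) by (intro D.minus_equality[symmetric, THEN sym]) (auto simp: l_neg)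
    then show ?thesis by (simp add: a_inv_def)
  qed
  show ?thesis
  proof (rule idealI)
    show "subgroup {x \<in> D. \<forall>A\<in>\<A>. u \<otimes> x \<in> A} (add_monoid (R\<lparr>carrier := D\<rparr>))"
    proof (rule group.subgroupI[OF D.a_group])
      show "{x \<in> D. \<forall>A\<in>\<A>. u \<otimes> x \<in> A} \<noteq> {}"
        using sub(2) u A(1) by (auto intro!: exI[of _ \<zero>])
    qed (use sub u DR A inv in \<open>auto simp: r_distr r_minus\<close>)
  next
    fix x d assume x: "x \<in> {x \<in> D. \<forall>A\<in>\<A>. u \<otimes> x \<in> A}" and d: "d \<in> carrier (R\<lparr>carrier := D\<rparr>)"
    then have "u \<otimes> (d \<otimes> x) = d \<otimes> (u \<otimes> x)"
      using u DR by (simp add: m_lcomm)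
    then show "d \<otimes>\<^bsub>R\<lparr>carrier := D\<rparr>\<^esub> x \<in> {x \<in> D. \<forall>A\<in>\<A>. u \<otimes> x \<in> A}"
      using x d sub DR A(4) by auto
    then show "x \<otimes>\<^bsub>R\<lparr>carrier := D\<rparr>\<^esub> d \<in> {x \<in> D. \<forall>A\<in>\<A>. u \<otimes> x \<in> A}"
      using x d DR by (simp add: m_comm)
  qed (rule D.ring_axioms)
qed

text \<open>The negated conclusion of uniform transversal boundedness in terms of elements:
  \<open>unbounded\<close> expresses that the intersection over every cofinite part of the family is
  zero.\<close>

locale unbounded_family = domain R for R :: "('a, 'b) ring_scheme" (structure) +
  fixes D :: "'a set" and I :: "'i set" and X :: "'i \<Rightarrow> 'a set set"
  assumes subdomain: "subdomain D R"
    and ideals: "\<And>i A. i \<in> I \<Longrightarrow> A \<in> X i \<Longrightarrow> ideal A R"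
    and unbounded: "\<And>r F. r \<in> carrier R \<Longrightarrow> r \<noteq> \<zero> \<Longrightarrow> finite F \<Longrightarrow> \<exists>i\<in>I - F. \<exists>A\<in>X i. r \<notin> A"
begin

lemma subcring: "subcring D R"
  using subdomain by (simp add: subdomain_def)

lemmas D_closed = subcringE[OF subcring]

lemma D_carrier: "d \<in> D \<Longrightarrow> d \<in> carrier R"
  using D_closed(1) by blast

lemma ideal_closed:
  assumes "i \<in> I" "A \<in> X i"
  shows "\<zero> \<in> A" "x \<in> A \<Longrightarrow> y \<in> A \<Longrightarrow> x \<ominus> y \<in> A" "x \<in> A \<Longrightarrow> r \<in> carrier R \<Longrightarrow> r \<otimes> x \<in> A"
proof -
  interpret ideal A R using ideals[OF assms] .
  show "\<zero> \<in> A" "x \<in> A \<Longrightarrow> y \<in> A \<Longrightarrow> x \<ominus> y \<in> A" "x \<in> A \<Longrightarrow> r \<in> carrier R \<Longrightarrow> r \<otimes> x \<in> A"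
    by (simp_all add: I_l_closed a_minus_def)
qed

text \<open>By \<open>fin\<close>, outside finitely many indices every member contains
  \<open>z \<otimes> a\<close> for some nonzero \<open>a\<close> in \<open>D\<close>. Multiplying
  \<open>p n\<close> by such an \<open>a\<close> for \<open>A n\<close> gives
  \<open>p (Suc n)\<close>. As \<open>R\<close> is a domain,
  \<open>z \<otimes> (c \<otimes> p (Suc n))\<close> is again nonzero, and \<open>unbounded\<close>
  supplies a member at a fresh index that misses it.\<close>

lemma avoiding_sequence:
  assumes z: "z \<in> carrier R" "z \<noteq> \<zero>" and c: "c \<in> D" "c \<noteq> \<zero>"
    and fin: "finite {i\<in>I. \<exists>A\<in>X i. \<forall>d\<in>D. z \<otimes> d \<in> A \<longrightarrow> d = \<zero>}"
  shows "\<exists>i A p. inj i \<and> (\<forall>n::nat. i n \<in> I \<and> A n \<in> X (i n) \<and> p n \<in> D \<and> z \<otimes> (c \<otimes> p n) \<notin> A n) \<and>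
    (\<forall>m n. m \<le> n \<longrightarrow> (\<exists>b\<in>D. p n = p m \<otimes> b)) \<and> (\<forall>m n. m < n \<longrightarrow> z \<otimes> p n \<in> A m)"
proof -
  have step: "\<exists>i A. i \<in> I \<and> i \<notin> U \<and> A \<in> X i \<and> z \<otimes> (c \<otimes> p) \<notin> A \<and> (\<exists>a\<in>D. a \<noteq> \<zero> \<and> z \<otimes> a \<in> A)"
    if "finite U" "p \<in> D" "p \<noteq> \<zero>" for U p
  proof -
    have "z \<otimes> (c \<otimes> p) \<noteq> \<zero>" "z \<otimes> (c \<otimes> p) \<in> carrier R"
      using that z c D_carrier by (auto simp: integral_iff)
    from unbounded[OF this(2,1) finite_UnI[OF that(1) fin]] obtain i A
      where "i \<in> I" "i \<notin> U" "\<not> (\<exists>A\<in>X i. \<forall>d\<in>D. z \<otimes> d \<in> A \<longrightarrow> d = \<zero>)" "A \<in> X i"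
        "z \<otimes> (c \<otimes> p) \<notin> A"
      by blast
    then show ?thesis by blast
  qed
  \<comment> \<open>\<open>U\<close> collects the used indices. The nonzero \<open>a\<close>
    demanded by \<open>P\<close> is kept for the next transition, where it becomes the factor in
    \<open>Q\<close>.\<close>
  define P where "P = (\<lambda>(U, i, A, p). finite U \<and> i \<in> U \<and> i \<in> I \<and> A \<in> X i \<and> p \<in> D \<and> p \<noteq> \<zero> \<and>
    z \<otimes> (c \<otimes> p) \<notin> A \<and> (\<exists>a\<in>D. a \<noteq> \<zero> \<and> z \<otimes> a \<in> A))"
  define Q where "Q = (\<lambda>(U, i :: 'i, A, p) (U', i' :: 'i, A' :: 'a set, p' :: 'a). i' \<notin> U \<and> U' = insert i' U \<and>
    (\<exists>a\<in>D. p' = p \<otimes> a \<and> z \<otimes> a \<in> A))"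
  have "\<exists>s. \<forall>n. P (s n) \<and> Q (s n) (s (Suc n))"
  proof (rule dependent_nat_choice)
    have "\<one> \<in> D" by (rule D_closed(3))
    from step[OF finite.emptyI this one_not_zero] obtain i A
      where "i \<in> I" "A \<in> X i" "z \<otimes> (c \<otimes> \<one>) \<notin> A" "\<exists>a\<in>D. a \<noteq> \<zero> \<and> z \<otimes> a \<in> A" by blast
    then have "P ({i}, i, A, \<one>)" using \<open>\<one> \<in> D\<close> by (simp add: P_def)
    then show "\<exists>s. P s" ..
  next
    fix s assume Ps: "P s"
    obtain U i A p where s: "s = (U, i, A, p)" by (cases s)
    obtain a where a: "a \<in> D" "a \<noteq> \<zero>" "z \<otimes> a \<in> A" and U: "finite U" and p: "p \<in> D" "p \<noteq> \<zero>"
      using Ps by (auto simp: s P_def)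
    have pa: "p \<otimes> a \<in> D" "p \<otimes> a \<noteq> \<zero>"
      using a p D_closed(6) D_carrier by (auto simp: integral_iff)
    from step[OF U pa] obtain i' A' where
      "i' \<in> I" "i' \<notin> U" "A' \<in> X i'" "z \<otimes> (c \<otimes> (p \<otimes> a)) \<notin> A'" "\<exists>a\<in>D. a \<noteq> \<zero> \<and> z \<otimes> a \<in> A'"
      by blast
    then have "P (insert i' U, i', A', p \<otimes> a) \<and> Q s (insert i' U, i', A', p \<otimes> a)"
      using U pa a by (auto simp: P_def Q_def s)
    then show "\<exists>s'. P s' \<and> Q s s'" ..
  qed
  then obtain s where s: "\<And>n. P (s n)" "\<And>n. Q (s n) (s (Suc n))" by blast
  define U where "U = (\<lambda>n. fst (s n))"
  define i where "i = (\<lambda>n. fst (snd (s n)))"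
  define A where "A = (\<lambda>n. fst (snd (snd (s n))))"
  define p where "p = (\<lambda>n. snd (snd (snd (s n))))"
  have s_eq: "s n = (U n, i n, A n, p n)" for n by (simp add: U_def A_def i_def p_def)
  have iU: "i n \<in> U n" and main: "i n \<in> I" "A n \<in> X (i n)" "p n \<in> D" "z \<otimes> (c \<otimes> p n) \<notin> A n" for n
    using s(1)[of n] by (auto simp: P_def s_eq)
  have i_Suc: "i (Suc n) \<notin> U n" and U_Suc: "U n \<subseteq> U (Suc n)"
    and p_Suc: "\<exists>a\<in>D. p (Suc n) = p n \<otimes> a \<and> z \<otimes> a \<in> A n" for n
    using s(2)[of n] by (auto simp: Q_def s_eq)
  have "i m \<noteq> i n" if "m < n" for m n
  proof -
    obtain k where k: "n = Suc k" "m \<le> k" using \<open>m < n\<close> by (cases n) auto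
    have "U m \<subseteq> U k" using U_Suc k(2) by (rule lift_Suc_mono_le)
    then show ?thesis using iU[of m] i_Suc[of k] k(1) by auto
  qed
  then have "inj i" by (metis injI linorder_neqE_nat)
  moreover have dvd: "\<exists>b\<in>D. p n = p m \<otimes> b" if "m \<le> n" for m n
    using that
  proof (induction n rule: dec_induct)
    case base
    show ?case using D_closed(3) main(3)[THEN D_carrier] by (intro bexI[of _ \<one>]) auto
  next
    case (step n)
    obtain b where b: "b \<in> D" "p n = p m \<otimes> b" using step.IH by blast
    obtain a where a: "a \<in> D" "p (Suc n) = p n \<otimes> a" using p_Suc by blast
    then have "p (Suc n) = p m \<otimes> (b \<otimes> a)"
      using b main(3) D_carrier by (simp add: m_assoc)
    then show ?case using a(1) b(1) D_closed(6) by blast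
  qed
  moreover have "z \<otimes> p n \<in> A m" if "m < n" for m n
  proof -
    \<comment> \<open>The shift by one matters: the factor that brings a multiple of
      \<open>z\<close> into \<open>A m\<close> enters only in \<open>p (Suc m)\<close>, which
      divides \<open>p n\<close>.\<close>
    obtain b where b: "b \<in> D" "p n = p (Suc m) \<otimes> b" using dvd[of "Suc m" n] \<open>m < n\<close> by auto
    obtain a where a: "a \<in> D" "p (Suc m) = p m \<otimes> a" "z \<otimes> a \<in> A m" using p_Suc by blast
    have "z \<otimes> p n = (p m \<otimes> b) \<otimes> (z \<otimes> a)"
      using a(1,2) b main(3)[of m] z(1) D_carrier by (simp add: m_ac)
    then show ?thesis
      using ideal_closed(3)[OF main(1,2) a(3)] b(1) main(3)[of m] D_carrier by simp
  qed
  ultimately show ?thesis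
    by (intro exI[of _ i] exI[of _ A] exI[of _ p] conjI allI impI) (simp_all add: main)
qed

text \<open>The contractions \<open>B n\<close> of the colon ideals have a stable subsequence
  \<open>S\<close> with finite part \<open>F\<close>. The condition on \<open>F\<close> may fail for
  \<open>d\<close> itself, but it holds for \<open>p n \<otimes> d\<close> once \<open>n\<close> is
  beyond \<open>F\<close>; therefore \<open>Q\<close> is formed with \<open>z \<otimes> p n\<close>
  instead of \<open>z\<close>.\<close>

lemma ideal_absorbing_partial_transversal:
  assumes krull: "has_krull_dimension TYPE('o) (R\<lparr>carrier := D\<rparr>)"
    and z: "z \<in> carrier R" "z \<noteq> \<zero>" and c: "c \<in> D" "c \<noteq> \<zero>"
    and fin: "finite {i\<in>I. \<exists>A\<in>X i. \<forall>d\<in>D. z \<otimes> d \<in> A \<longrightarrow> d = \<zero>}"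
  shows "\<exists>\<tau> Q. partial_transversal I X \<tau> \<and> ideal Q (R\<lparr>carrier := D\<rparr>) \<and> c \<notin> Q \<and>
    (\<forall>K\<subseteq>\<tau>. infinite K \<longrightarrow> (\<forall>d\<in>D. (\<forall>(i, A)\<in>K. z \<otimes> d \<in> A) \<longrightarrow> d \<in> Q))"
proof -
  obtain i A p where inj: "inj i"
    and main: "\<And>n::nat. i n \<in> I" "\<And>n. A n \<in> X (i n)" "\<And>n. p n \<in> D" "\<And>n. z \<otimes> (c \<otimes> p n) \<notin> A n"
    and dvd: "\<And>m n. m \<le> n \<Longrightarrow> \<exists>b\<in>D. p n = p m \<otimes> b"
    and later: "\<And>m n. m < n \<Longrightarrow> z \<otimes> p n \<in> A m"
    using avoiding_sequence[OF z c fin] by metis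
  interpret D: ring "R\<lparr>carrier := D\<rparr>"
    using subcring by (intro subring_is_ring) (simp add: subcring_def)
  define B where "B = (\<lambda>n. {x \<in> D. \<forall>A'\<in>{A n}. z \<otimes> x \<in> A'})"
  have "ideal (B n) (R\<lparr>carrier := D\<rparr>)" for n
    unfolding B_def using ideals main(1,2) z(1) by (intro subcring_colon_ideal[OF subcring]) auto
  then have "\<exists>F S. finite F \<and> infinite S \<and>
      (\<forall>x\<in>D. (\<forall>j\<in>F. x \<in> B j) \<longrightarrow> infinite {j\<in>S. x \<in> B j} \<longrightarrow> (\<forall>j\<in>S. x \<in> B j))"
    using D.krull_dimension_stable_subsequence[of B, OF krull] by simp
  then obtain F S where F: "finite F" and S: "infinite S"
      and st: "\<forall>x\<in>D. (\<forall>j\<in>F. x \<in> B j) \<longrightarrow> infinite {j\<in>S. x \<in> B j} \<longrightarrow> (\<forall>j\<in>S. x \<in> B j)"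
    by (elim exE conjE) (rule that)
  have stable: "x \<in> B j"
    if "x \<in> D" "\<forall>j\<in>F. x \<in> B j" "infinite {j\<in>S. x \<in> B j}" "j \<in> S" for x j
    by (rule bspec[OF mp[OF mp[OF bspec[OF st that(1)] that(2)] that(3)] that(4)])
  obtain n where n: "\<And>j. j \<in> F \<Longrightarrow> j < n"
    using finite_nat_set_iff_bounded[THEN iffD1, OF F] by blast
  \<comment> \<open>For \<open>k \<ge> n\<close> the element \<open>p n\<close> divides
    \<open>p k\<close>, which is what keeps \<open>c\<close> out of \<open>Q\<close>.\<close>
  define S' where "S' = S \<inter> {n..}"
  have S': "infinite S'"
  proof
    assume "finite S'"
    then have "finite (S' \<union> {..<n})" by simp
    moreover have "S \<subseteq> S' \<union> {..<n}" by (auto simp: S'_def)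
    ultimately show False using S finite_subset by blast
  qed
  define Q where "Q = {x \<in> D. \<forall>A'\<in>A ` S'. (z \<otimes> p n) \<otimes> x \<in> A'}"
  have pn: "p n \<in> carrier R" using main(3) D_carrier by blast
  have Q: "ideal Q (R\<lparr>carrier := D\<rparr>)"
    unfolding Q_def using ideals main(1,2) z(1) pn by (intro subcring_colon_ideal[OF subcring]) auto
  have "c \<notin> Q"
  proof
    assume cQ: "c \<in> Q"
    obtain k where k: "k \<in> S'" using S' by (metis ex_in_conv finite.emptyI)
    then have "n \<le> k" by (simp add: S'_def)
    then obtain b where b: "b \<in> D" "p k = p n \<otimes> b" using dvd by blast
    have "z \<otimes> (c \<otimes> p k) = b \<otimes> ((z \<otimes> p n) \<otimes> c)"
      using b z(1) pn c(1) D_carrier by (simp add: m_ac)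
    moreover have "(z \<otimes> p n) \<otimes> c \<in> A k" using cQ k by (auto simp: Q_def)
    ultimately have "z \<otimes> (c \<otimes> p k) \<in> A k"
      using ideal_closed(3)[OF main(1,2)] b(1) D_carrier by simp
    then show False using main(4) by blast
  qed
  define g where "g = (\<lambda>k. (i k, A k))"
  have inj_g: "inj g" using inj by (auto simp: g_def inj_def)
  have "partial_transversal I X (g ` S')"
    unfolding partial_transversal_def
  proof (intro conjI)
    show "infinite (g ` S')"
      using S' inj_g finite_imageD inj_on_subset by blast
    show "inj_on fst (g ` S')"
      using inj by (auto simp: g_def inj_on_def inj_def)
    show "g ` S' \<subseteq> Sigma I X" using main(1,2) by (auto simp: g_def)
  qed
  moreover have "d \<in> Q" if K: "K \<subseteq> g ` S'" "infinite K" and d: "d \<in> D"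
    and mem: "\<forall>(i, A)\<in>K. z \<otimes> d \<in> A" for K d
  proof -
    have dR: "d \<in> carrier R" using d D_carrier by blast
    have pd: "p n \<otimes> d \<in> D" using main(3) d D_closed(6) by blast
    have "K = g ` {k\<in>S'. g k \<in> K}" using K(1) by blast
    then have inf: "infinite {k\<in>S'. g k \<in> K}" using K(2) finite_imageI by metis
    have "z \<otimes> (p n \<otimes> d) \<in> A j" if "z \<otimes> d \<in> A j" for j
    proof -
      have "z \<otimes> (p n \<otimes> d) = p n \<otimes> (z \<otimes> d)" using z(1) pn dR by (simp add: m_lcomm)
      then show ?thesis using ideal_closed(3)[OF main(1,2) that pn] by simp
    qed
    then have "{k\<in>S'. g k \<in> K} \<subseteq> {j\<in>S. p n \<otimes> d \<in> B j}"
      using mem pd by (auto simp: B_def g_def S'_def)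
    then have inf': "infinite {j\<in>S. p n \<otimes> d \<in> B j}" using inf by (rule infinite_super)
    \<comment> \<open>Every \<open>j\<close> in \<open>F\<close> is below \<open>n\<close>, so
      \<open>z \<otimes> p n\<close> lies in \<open>A j\<close> by \<open>later\<close>.\<close>
    have F': "\<forall>j\<in>F. p n \<otimes> d \<in> B j"
    proof
      fix j assume "j \<in> F"
      then have "d \<otimes> (z \<otimes> p n) \<in> A j" using later[OF n] ideal_closed(3)[OF main(1,2)] dR by blast
      moreover have "z \<otimes> (p n \<otimes> d) = d \<otimes> (z \<otimes> p n)" using z(1) pn dR by (simp add: m_ac)
      ultimately show "p n \<otimes> d \<in> B j" using pd by (simp add: B_def)
    qed
    have "z \<otimes> p n \<otimes> d \<in> A j" if "j \<in> S'" for j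
    proof -
      have "p n \<otimes> d \<in> B j"
        using that by (intro stable[OF pd F' inf']) (simp add: S'_def)
      then show ?thesis using z(1) pn dR by (simp add: B_def m_assoc)
    qed
    then show "d \<in> Q" using d by (simp add: Q_def)
  qed
  ultimately show ?thesis using Q \<open>c \<notin> Q\<close>
    by (intro exI[of _ "g ` S'"] exI[of _ Q] conjI allI impI ballI)
qed

text \<open>If infinitely many indices have a member meeting \<open>D z\<close> in zero, one partial
  transversal through such members suffices, since any single pair of it separates. Otherwise every
  nonzero \<open>c\<close> has an absorbing ideal \<open>Q c\<close> without \<open>c\<close>; these
  ideals intersect in zero, and so do countably many of them.\<close>

lemma countably_separated_cyclic:
  assumes krull: "has_krull_dimension TYPE('o) (R\<lparr>carrier := D\<rparr>)"
    and wpb: "weakly_productively_bounded (R\<lparr>carrier := D\<rparr>)"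
    and z: "z \<in> carrier R" "z \<noteq> \<zero>"
  shows "countably_separated R I X ((\<otimes>) z ` D)"
proof (cases "finite {i\<in>I. \<exists>A\<in>X i. \<forall>d\<in>D. z \<otimes> d \<in> A \<longrightarrow> d = \<zero>}")
  case False
  define J where "J = {i\<in>I. \<exists>A\<in>X i. \<forall>d\<in>D. z \<otimes> d \<in> A \<longrightarrow> d = \<zero>}"
  have "\<forall>i\<in>J. \<exists>A\<in>X i. \<forall>d\<in>D. z \<otimes> d \<in> A \<longrightarrow> d = \<zero>" by (simp add: J_def)
  then obtain A where A: "\<And>i. i \<in> J \<Longrightarrow> A i \<in> X i"
      "\<And>i d. i \<in> J \<Longrightarrow> d \<in> D \<Longrightarrow> z \<otimes> d \<in> A i \<Longrightarrow> d = \<zero>"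
    by metis
  define \<tau> where "\<tau> = (\<lambda>i. (i, A i)) ` J"
  have "inj_on (\<lambda>i. (i, A i)) J" by (auto simp: inj_on_def)
  then have "infinite \<tau>" unfolding \<tau>_def using False J_def finite_imageD by blast
  then have "partial_transversal I X \<tau>"
    unfolding partial_transversal_def using A(1) by (auto simp: \<tau>_def J_def inj_on_def)
  moreover have "separates R {\<tau>} ((\<otimes>) z ` D)"
  proof (rule separatesI)
    fix K x assume K: "\<And>\<sigma>. \<sigma> \<in> {\<tau>} \<Longrightarrow> K \<sigma> \<subseteq> \<sigma>" "\<And>\<sigma>. \<sigma> \<in> {\<tau>} \<Longrightarrow> infinite (K \<sigma>)"
      and x: "x \<in> (\<otimes>) z ` D" "\<And>\<sigma> i A. \<sigma> \<in> {\<tau>} \<Longrightarrow> (i, A) \<in> K \<sigma> \<Longrightarrow> x \<in> A"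
    have "K \<tau> \<noteq> {}" using K(2)[of \<tau>] by auto
    then obtain i where i: "i \<in> J" "(i, A i) \<in> K \<tau>" using K(1)[of \<tau>] by (auto simp: \<tau>_def)
    obtain d where d: "d \<in> D" "x = z \<otimes> d" using x(1) by blast
    then have "d = \<zero>" using A(2)[OF i(1) d(1)] x(2)[OF _ i(2)] by simp
    then show "x = \<zero>" using d(2) z(1) by simp
  qed
  ultimately show ?thesis unfolding countably_separated_def by (intro exI[of _ "{\<tau>}"]) simp
next
  case True
  let ?D = "R\<lparr>carrier := D\<rparr>"
  interpret D: domain ?D using subdomain by (rule subdomain_is_domain)
  define good where "good = (\<lambda>c \<tau> Q. partial_transversal I X \<tau> \<and> ideal Q ?D \<and> c \<notin> Q \<and>
    (\<forall>K\<subseteq>\<tau>. infinite K \<longrightarrow> (\<forall>d\<in>D. (\<forall>(i, A)\<in>K. z \<otimes> d \<in> A) \<longrightarrow> d \<in> Q)))"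
  have "\<forall>c\<in>D - {\<zero>}. \<exists>\<tau> Q. good c \<tau> Q"
    unfolding good_def by (intro ballI ideal_absorbing_partial_transversal[OF krull z _ _ True]) auto
  then obtain \<tau> Q where good: "\<And>c. c \<in> D - {\<zero>} \<Longrightarrow> good c (\<tau> c) (Q c)"
    by metis
  have \<tau>: "partial_transversal I X (\<tau> c)" and Q: "ideal (Q c) ?D" "c \<notin> Q c"
    if "c \<in> D - {\<zero>}" for c
    using good[OF that] by (simp_all add: good_def)
  have absorb: "d \<in> Q c"
    if "c \<in> D - {\<zero>}" "K \<subseteq> \<tau> c" "infinite K" "d \<in> D" "\<forall>(i, A)\<in>K. z \<otimes> d \<in> A" for c K d
    using good[OF that(1)] that(2-) by (simp add: good_def)
  have "\<exists>\<C>\<subseteq>Q ` (D - {\<zero>}). countable \<C> \<and> (\<forall>d\<in>carrier ?D. d \<noteq> \<zero>\<^bsub>?D\<^esub> \<longrightarrow> (\<exists>P\<in>\<C>. d \<notin> P))"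
    using Q by (intro D.weakly_productively_bounded_countable_subfamily[OF wpb]) auto
  then obtain \<C> where \<C>: "\<C> \<subseteq> Q ` (D - {\<zero>})" "countable \<C>"
      "\<And>d. d \<in> D \<Longrightarrow> d \<noteq> \<zero> \<Longrightarrow> \<exists>P\<in>\<C>. d \<notin> P" by auto
  \<comment> \<open>Countably many \<open>c\<close> represent the ideals in \<C>, so only countably
    many \<open>\<tau> c\<close> are used.\<close>
  obtain C where C: "C \<subseteq> D - {\<zero>}" "countable C" "\<C> = Q ` C"
    using countable_image_eq_inj \<C>(1,2) by (metis countable_subset_image)
  have "separates R (\<tau> ` C) ((\<otimes>) z ` D)"
  proof (rule separatesI)
    fix K x assume K: "\<And>\<sigma>. \<sigma> \<in> \<tau> ` C \<Longrightarrow> K \<sigma> \<subseteq> \<sigma>" "\<And>\<sigma>. \<sigma> \<in> \<tau> ` C \<Longrightarrow> infinite (K \<sigma>)"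
      and x: "x \<in> (\<otimes>) z ` D" "\<And>\<sigma> i A. \<sigma> \<in> \<tau> ` C \<Longrightarrow> (i, A) \<in> K \<sigma> \<Longrightarrow> x \<in> A"
    obtain d where d: "d \<in> D" "x = z \<otimes> d" using x(1) by blast
    have "d \<in> Q c" if c: "c \<in> C" for c
    proof (rule absorb)
      show "c \<in> D - {\<zero>}" using c C(1) by blast
      show "K (\<tau> c) \<subseteq> \<tau> c" "infinite (K (\<tau> c))" using K c by blast+
      show "\<forall>(i, A)\<in>K (\<tau> c). z \<otimes> d \<in> A" using x(2) c d(2) by blast
    qed (rule d(1))
    then have "d = \<zero>" using \<C>(3)[OF d(1)] C(3) by blast
    then show "x = \<zero>" using d(2) z(1) by simp
  qed
  then show ?thesis
    unfolding countably_separated_def using C(1,2) \<tau> by (intro exI[of _ "\<tau> ` C"]) auto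
qed

section \<open>Finitely generated \<open>D\<close>-submodules\<close>

text \<open>The \<open>D\<close>-submodule generated by the list, in a recursive form that splits
  off one generator for the induction in \<open>countably_separated_dspan\<close>.\<close>

primrec dspan :: "'a list \<Rightarrow> 'a set" where
  "dspan [] = {\<zero>}"
| "dspan (m # ms) = {x \<oplus> m \<otimes> d | x d. x \<in> dspan ms \<and> d \<in> D}"

lemma dspan_carrier:
  "set ms \<subseteq> carrier R \<Longrightarrow> dspan ms \<subseteq> carrier R"
  by (induction ms) (auto simp: D_carrier subset_iff)

lemma dspan_minus_closed:
  "set ms \<subseteq> carrier R \<Longrightarrow> x \<in> dspan ms \<Longrightarrow> y \<in> dspan ms \<Longrightarrow> x \<ominus> y \<in> dspan ms"
proof (induction ms arbitrary: x y)
  case Nil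
  then show ?case by simp
next
  case (Cons m ms)
  obtain u d v e where u: "u \<in> dspan ms" "d \<in> D" "x = u \<oplus> m \<otimes> d"
    and v: "v \<in> dspan ms" "e \<in> D" "y = v \<oplus> m \<otimes> e"
    using Cons.prems by auto
  have ms: "set ms \<subseteq> carrier R" "m \<in> carrier R" using Cons.prems(1) by auto
  have "u \<in> carrier R" "v \<in> carrier R" "d \<in> carrier R" "e \<in> carrier R"
    using dspan_carrier[OF ms(1)] u(1) v(1) D_carrier[OF u(2)] D_carrier[OF v(2)] by blast+
  then have "x \<ominus> y = (u \<ominus> v) \<oplus> m \<otimes> (d \<ominus> e)"
    unfolding u(3) v(3) using ms(2) by algebra
  moreover have "u \<ominus> v \<in> dspan ms" by (rule Cons.IH[OF ms(1) u(1) v(1)])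
  moreover have "d \<ominus> e \<in> D"
    unfolding a_minus_def by (intro D_closed(7)[OF u(2) D_closed(5)[OF v(2)]])
  ultimately show ?case by auto
qed

lemma dspan_smult_closed:
  "set ms \<subseteq> carrier R \<Longrightarrow> c \<in> D \<Longrightarrow> x \<in> dspan ms \<Longrightarrow> c \<otimes> x \<in> dspan ms"
proof (induction ms arbitrary: x)
  case Nil
  then show ?case using D_carrier by simp
next
  case (Cons m ms)
  obtain u d where u: "u \<in> dspan ms" "d \<in> D" "x = u \<oplus> m \<otimes> d" using Cons.prems by auto
  have ms: "set ms \<subseteq> carrier R" "m \<in> carrier R" using Cons.prems(1) by auto
  have "u \<in> carrier R" "d \<in> carrier R" "c \<in> carrier R"
    using dspan_carrier[OF ms(1)] u(1) D_carrier[OF u(2)] D_carrier[OF Cons.prems(2)] by blast+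
  then have "c \<otimes> x = c \<otimes> u \<oplus> m \<otimes> (c \<otimes> d)"
    unfolding u(3) using ms(2) by algebra
  moreover have "c \<otimes> u \<in> dspan ms" by (rule Cons.IH[OF ms(1) Cons.prems(2) u(1)])
  moreover have "c \<otimes> d \<in> D" using Cons.prems(2) u(2) by (rule D_closed(6))
  ultimately show ?case by auto
qed

text \<open>
  If \<open>T\<close> separates \<open>dspan ms\<close>, any common element \<open>z\<close> of \<open>dspan (m # ms)\<close> has nonzero \<open>m\<close>-coordinate,
  and every other one is proportional to it over \<open>D\<close>; so it remains to separate \<open>D z\<close>.
\<close>

lemma countably_separated_dspan:
  assumes krull: "has_krull_dimension TYPE('o) (R\<lparr>carrier := D\<rparr>)"
    and wpb: "weakly_productively_bounded (R\<lparr>carrier := D\<rparr>)"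
    and ms: "set ms \<subseteq> carrier R"
  shows "countably_separated R I X (dspan ms)"
  using ms
proof (induction ms)
  case Nil
  have "separates R {} {\<zero>}" by (simp add: separates_def)
  then show ?case unfolding countably_separated_def by (intro exI[of _ "{}"]) simp
next
  case (Cons m ms)
  have mR: "m \<in> carrier R" and msR: "set ms \<subseteq> carrier R" using Cons.prems by auto
  note closed = dspan_carrier[OF msR] dspan_minus_closed[OF msR] dspan_smult_closed[OF msR]
  obtain T where T: "countable T" "\<And>\<tau>. \<tau> \<in> T \<Longrightarrow> partial_transversal I X \<tau>"
      "separates R T (dspan ms)"
    using Cons.IH[OF msR] unfolding countably_separated_def by blast
  show ?case
  proof (cases "separates R T (dspan (m # ms))")
    case True
    then show ?thesis using T unfolding countably_separated_def by blast
  next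
    case False
    then obtain K z where K: "\<And>\<tau>. \<tau> \<in> T \<Longrightarrow> K \<tau> \<subseteq> \<tau>" "\<And>\<tau>. \<tau> \<in> T \<Longrightarrow> infinite (K \<tau>)"
      and z: "z \<in> dspan (m # ms)" "\<And>\<tau> i A. \<tau> \<in> T \<Longrightarrow> (i, A) \<in> K \<tau> \<Longrightarrow> z \<in> A" "z \<noteq> \<zero>"
      using separatesI[of T "dspan (m # ms)" R] by blast
    obtain u c where u: "u \<in> dspan ms" "c \<in> D" "z = u \<oplus> m \<otimes> c" using z(1) by auto
    have uR: "u \<in> carrier R" and cR: "c \<in> carrier R" using u closed(1) D_carrier by auto
    have zR: "z \<in> carrier R" using u(3) uR cR mR by simp
    have "c \<noteq> \<zero>"
    proof
      assume "c = \<zero>"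
      then have "z \<in> dspan ms" using u uR mR by simp
      then have "z = \<zero>" using K z(2) by (intro separatesD[OF T(3), of K]) blast+
      then show False using z(3) by blast
    qed
    obtain T' where T': "countable T'" "\<And>\<tau>. \<tau> \<in> T' \<Longrightarrow> partial_transversal I X \<tau>"
        "separates R T' ((\<otimes>) z ` D)"
      using countably_separated_cyclic[OF krull wpb zR z(3)] unfolding countably_separated_def by blast
    \<comment> \<open>Replacing each \<tau> in \<open>T\<close> by \<open>K \<tau>\<close> keeps
      \<open>z\<close> in all ideals concerned. A thinning of \<open>K \<tau>\<close> is also one of
      \<tau>, so \<open>T\<close> still controls \<open>dspan ms\<close>.\<close>
    have "separates R (K ` T \<union> T') (dspan (m # ms))"
    proof (rule separatesI)
      fix L y
      assume L: "\<And>\<tau>. \<tau> \<in> K ` T \<union> T' \<Longrightarrow> L \<tau> \<subseteq> \<tau>" "\<And>\<tau>. \<tau> \<in> K ` T \<union> T' \<Longrightarrow> infinite (L \<tau>)"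
        and y: "y \<in> dspan (m # ms)" "\<And>\<tau> i A. \<tau> \<in> K ` T \<union> T' \<Longrightarrow> (i, A) \<in> L \<tau> \<Longrightarrow> y \<in> A"
      obtain v e where v: "v \<in> dspan ms" "e \<in> D" "y = v \<oplus> m \<otimes> e" using y(1) by auto
      have vR: "v \<in> carrier R" and eR: "e \<in> carrier R" using v closed(1) D_carrier by auto
      have yR: "y \<in> carrier R" using v(3) vR eR mR by simp
      \<comment> \<open>This combination cancels the \<open>m\<close>-coordinates and so falls into
        \<open>dspan ms\<close>; it lies in the ideals left in each \<open>K \<tau>\<close> by
        \<open>L\<close> because \<open>y\<close> and \<open>z\<close> do.\<close>
      have "c \<otimes> y \<ominus> e \<otimes> z = c \<otimes> v \<ominus> e \<otimes> u"
        unfolding u(3) v(3) using uR cR vR eR mR by algebra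
      also have "\<dots> \<in> dspan ms" using closed(2,3) u v by blast
      finally have "c \<otimes> y \<ominus> e \<otimes> z = \<zero>"
      proof (rule separatesD[OF T(3), of "\<lambda>\<tau>. L (K \<tau>)", rotated 2])
        show "L (K \<tau>) \<subseteq> \<tau>" "infinite (L (K \<tau>))" if "\<tau> \<in> T" for \<tau>
          using that L[of "K \<tau>"] K(1) by blast+
        fix \<tau> i A assume \<tau>: "\<tau> \<in> T" "(i, A) \<in> L (K \<tau>)"
        then have "(i, A) \<in> K \<tau>" using L(1)[of "K \<tau>"] by blast
        then have "z \<in> A" "i \<in> I" "A \<in> X i"
          using z(2) K(1) T(2) \<tau>(1) unfolding partial_transversal_def by blast+
        moreover have "y \<in> A" using y(2) \<tau> by blast
        ultimately show "c \<otimes> y \<ominus> e \<otimes> z \<in> A" using ideal_closed cR eR by simp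
      qed
      then have eq: "c \<otimes> y = z \<otimes> e"
        using cR yR eR zR by (metis m_closed m_comm r_right_minus_eq)
      \<comment> \<open>Now \<open>c \<otimes> y\<close> belongs to \<open>D z\<close>, where
        \<open>T'\<close> separates; afterwards \<open>c\<close> is cancelled.\<close>
      have "c \<otimes> y = \<zero>"
      proof (rule separatesD[OF T'(3), of L])
        show "L \<tau> \<subseteq> \<tau>" "infinite (L \<tau>)" if "\<tau> \<in> T'" for \<tau> using that L by blast+
        show "c \<otimes> y \<in> (\<otimes>) z ` D" using eq v(2) by blast
        fix \<tau> i A assume \<tau>: "\<tau> \<in> T'" "(i, A) \<in> L \<tau>"
        then have "i \<in> I" "A \<in> X i"
          using L(1) T'(2) unfolding partial_transversal_def by blast+
        then show "c \<otimes> y \<in> A" using ideal_closed(3) y(2) \<tau> cR by blast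
      qed
      then show "y = \<zero>" using \<open>c \<noteq> \<zero>\<close> cR yR integral by blast
    qed
    moreover have "countable (K ` T \<union> T')" using T(1) T'(1) by simp
    moreover have "partial_transversal I X \<tau>" if "\<tau> \<in> K ` T \<union> T'" for \<tau>
      using that T(2) T'(2) K partial_transversal_subset by blast
    ultimately show ?thesis unfolding countably_separated_def by blast
  qed
qed

section \<open>Covering \<open>R\<close> by countably many finitely generated submodules\<close>

text \<open>\<open>M\<close> is the countable monoid of all monomials in \<open>S\<close>. The
  \<open>D\<close>-combinations of monomials form a subring \<open>U\<close> that contains
  \<open>D\<close> and \<open>S\<close>, hence all of \<open>R\<close>.\<close>

lemma countable_dspan_cover:
  assumes "countably_generated_over R D"
  shows "\<exists>M. countable M \<and> M \<subseteq> carrier R \<and> carrier R \<subseteq> (\<Union>ms\<in>lists M. dspan ms)"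
proof -
  obtain S where S: "countable S" "S \<subseteq> carrier R" "carrier R = generate_ring R (D \<union> S)"
    using assms unfolding countably_generated_over_def by blast
  define prd where "prd = (\<lambda>xs. foldr (\<otimes>) xs \<one>)"
  define M where "M = prd ` lists S"
  have prd_closed: "prd xs \<in> carrier R" if "xs \<in> lists S" for xs
    using that S(2) by (induction xs) (auto simp: prd_def)
  have prd_append: "prd (xs @ ys) = prd xs \<otimes> prd ys" if "xs \<in> lists S" "ys \<in> lists S" for xs ys
    using that(1)
  proof (induction xs)
    case Nil
    then show ?case using prd_closed[OF that(2)] by (simp add: prd_def)
  next
    case (Cons x xs)
    then show ?case using prd_closed[OF that(2)] prd_closed[OF Cons.hyps(2)] S(2)
      by (auto simp: prd_def m_assoc)
  qed
  have MR: "M \<subseteq> carrier R" using prd_closed by (auto simp: M_def)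
  have M_mult: "m \<otimes> m' \<in> M" if mm: "m \<in> M" "m' \<in> M" for m m'
  proof -
    obtain xs ys where "xs \<in> lists S" "ys \<in> lists S" "m = prd xs" "m' = prd ys"
      using mm by (auto simp: M_def)
    then show ?thesis using prd_append unfolding M_def
      by (intro image_eqI[of _ _ "xs @ ys"]) auto
  qed
  have one_M: "\<one> \<in> M" unfolding M_def by (rule image_eqI[of _ _ "[]"]) (auto simp: prd_def)
  have SM: "S \<subseteq> M"
  proof
    fix s assume "s \<in> S"
    then show "s \<in> M" unfolding M_def
      using S(2) by (intro image_eqI[of _ _ "[s]"]) (auto simp: prd_def)
  qed
  define U where "U = (\<Union>ms\<in>lists M. dspan ms)"
  have dspan_R: "dspan ms \<subseteq> carrier R" if "ms \<in> lists M" for ms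
    using dspan_carrier[of ms] that MR by auto
  have UR: "U \<subseteq> carrier R" using dspan_R by (auto simp: U_def)
  have mono_U: "m \<otimes> d \<in> U" if "m \<in> M" "d \<in> D" for m d
  proof -
    have "m \<otimes> d \<in> carrier R" using that MR D_carrier by auto
    then have "m \<otimes> d \<in> dspan [m]" using that by (auto intro!: exI[of _ d])
    then show ?thesis unfolding U_def using that by (intro UN_I[of "[m]"]) auto
  qed
  have span_append: "x \<oplus> y \<in> dspan (ms @ ns)"
    if "ms \<in> lists M" "ns \<in> lists M" "x \<in> dspan ms" "y \<in> dspan ns" for ms ns x y
    using that(1,3)
  proof (induction ms arbitrary: x)
    case Nil
    then show ?case using that(4) dspan_R[OF that(2)] by auto
  next
    case (Cons m ms)
    obtain u d where u: "u \<in> dspan ms" "d \<in> D" "x = u \<oplus> m \<otimes> d" using Cons.prems by auto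
    have "u \<in> carrier R" "m \<in> carrier R" "d \<in> carrier R" "y \<in> carrier R"
      using u dspan_R[OF Cons.hyps(2)] dspan_R[OF that(2)] that(4) Cons.hyps(1) MR D_carrier by auto
    then have "x \<oplus> y = (u \<oplus> y) \<oplus> m \<otimes> d" unfolding u(3) by algebra
    then show ?case using Cons.IH[OF u(1)] u(2) by auto
  qed
  have U_add: "x \<oplus> y \<in> U" if xy: "x \<in> U" "y \<in> U" for x y
  proof -
    obtain ms ns where "ms \<in> lists M" "x \<in> dspan ms" "ns \<in> lists M" "y \<in> dspan ns"
      using xy by (auto simp: U_def)
    then show ?thesis
      unfolding U_def using span_append by (intro UN_I[of "ms @ ns"]) auto
  qed
  have U_zero: "\<zero> \<in> U" unfolding U_def by (intro UN_I[of "[]"]) auto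
  \<comment> \<open>Products are expanded by two inductions: first a single term times a
    combination, then, in \<open>span_mult\<close>, a combination times a combination.\<close>
  have mono_mult: "(m \<otimes> d) \<otimes> y \<in> U" if "m \<in> M" "d \<in> D" "ns \<in> lists M" "y \<in> dspan ns" for m d y ns
    using that(3,4)
  proof (induction ns arbitrary: y)
    case Nil
    then show ?case using that MR D_carrier U_zero by auto
  next
    case (Cons n ns)
    obtain u e where u: "u \<in> dspan ns" "e \<in> D" "y = u \<oplus> n \<otimes> e" using Cons.prems by auto
    have "u \<in> carrier R" "m \<in> carrier R" "n \<in> carrier R" "d \<in> carrier R" "e \<in> carrier R"
      using u dspan_R[OF Cons.hyps(2)] Cons.hyps(1) that(1,2) MR D_carrier by auto
    then have "(m \<otimes> d) \<otimes> y = (m \<otimes> d) \<otimes> u \<oplus> (m \<otimes> n) \<otimes> (d \<otimes> e)" unfolding u(3) by algebra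
    moreover have "(m \<otimes> n) \<otimes> (d \<otimes> e) \<in> U"
      using mono_U M_mult that(1,2) Cons.hyps(1) u(2) D_closed(6) by simp
    ultimately show ?case using U_add Cons.IH[OF u(1)] by simp
  qed
  have span_mult: "x \<otimes> y \<in> U" if "ms \<in> lists M" "x \<in> dspan ms" "y \<in> U" for x y ms
    using that(1,2)
  proof (induction ms arbitrary: x)
    case Nil
    then show ?case using that(3) UR U_zero by auto
  next
    case (Cons m ms)
    obtain u d where u: "u \<in> dspan ms" "d \<in> D" "x = u \<oplus> m \<otimes> d" using Cons.prems by auto
    have "u \<in> carrier R" "m \<in> carrier R" "d \<in> carrier R" "y \<in> carrier R"
      using u dspan_R[OF Cons.hyps(2)] that(3) UR Cons.hyps(1) MR D_carrier by auto
    then have "x \<otimes> y = u \<otimes> y \<oplus> (m \<otimes> d) \<otimes> y" unfolding u(3) by algebra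
    moreover obtain ns where "ns \<in> lists M" "y \<in> dspan ns"
      using \<open>y \<in> U\<close> by (auto simp: U_def)
    then have "(m \<otimes> d) \<otimes> y \<in> U" by (rule mono_mult[OF Cons.hyps(1) u(2)])
    ultimately show ?case using U_add Cons.IH[OF u(1)] by simp
  qed
  have U_mult: "x \<otimes> y \<in> U" if xy: "x \<in> U" "y \<in> U" for x y
  proof -
    obtain ms where "ms \<in> lists M" "x \<in> dspan ms" using xy(1) by (auto simp: U_def)
    then show ?thesis using xy(2) by (rule span_mult)
  qed
  have U_D: "d \<in> U" if "d \<in> D" for d
    using mono_U[OF one_M that] D_carrier[OF that] by simp
  have U_S: "s \<in> U" if "s \<in> S" for s
    using mono_U[OF subsetD[OF SM that] D_closed(3)] subsetD[OF S(2) that] by simp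
  have "x \<in> U" if "x \<in> generate_ring R (D \<union> S)" for x
    using that
  proof induction
    case one
    show ?case using U_D D_closed(3) by blast
  next
    case (incl h)
    then show ?case using U_D U_S by blast
  next
    \<comment> \<open>Negation is multiplication by \<open>\<ominus> \<one>\<close>, which lies in
      \<open>D\<close>.\<close>
    case (a_inv h)
    have "\<ominus> \<one> \<in> U" using U_D D_closed(3,5) by blast
    then have "\<ominus> \<one> \<otimes> h \<in> U" using U_mult a_inv.IH by blast
    then show ?case using a_inv.IH UR by (metis l_minus l_one one_closed subsetD)
  qed (use U_add U_mult in blast)+
  moreover have "countable M" unfolding M_def using S(1) by simp
  ultimately show ?thesis using MR S(3) unfolding U_def by blast
qed

section \<open>Assembling one transversal\<close>

lemma unbounded_transversal:
  assumes sep: "countably_separated R I X (carrier R)" and nonempty: "\<And>i. i \<in> I \<Longrightarrow> X i \<noteq> {}"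
  shows "\<exists>x\<in>(\<Pi>\<^sub>E i\<in>I. X i). \<forall>r\<in>carrier R. (\<forall>i\<in>I. r \<in> x i) \<longrightarrow> r = \<zero>"
proof -
  obtain T where T: "countable T" "\<And>\<tau>. \<tau> \<in> T \<Longrightarrow> partial_transversal I X \<tau>"
      "separates R T (carrier R)"
    using sep unfolding countably_separated_def by blast
  have "T \<noteq> {}"
  proof
    assume "T = {}"
    then show False using separatesD[OF T(3), of id \<one>] by simp
  qed
  \<comment> \<open>Ignoring the second component of the decoded pair repeats each member of
    \<open>T\<close> infinitely often.\<close>
  define t where "t = (\<lambda>e. from_nat_into T (fst (prod_decode e)))"
  have tT: "t e \<in> T" for e unfolding t_def using \<open>T \<noteq> {}\<close> by (rule from_nat_into)
  have "\<exists>f. \<forall>e. f e \<in> t e \<and> fst (f e) \<notin> fst ` f ` {..<e}"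
  proof (rule dependent_wellorder_choice)
    fix e f assume "\<And>k. k < e \<Longrightarrow> f k \<in> t k \<and> fst (f k) \<notin> fst ` f ` {..<k}"
    have "infinite (fst ` t e)"
      using T(2)[OF tT[of e]] finite_imageD unfolding partial_transversal_def by blast
    then have "\<not> fst ` t e \<subseteq> fst ` f ` {..<e}" by (meson finite_imageI finite_lessThan finite_subset)
    then show "\<exists>r. r \<in> t e \<and> fst r \<notin> fst ` f ` {..<e}" by blast
  qed (metis image_cong lessThan_iff)
  then obtain f where f: "\<And>e. f e \<in> t e" "\<And>e. fst (f e) \<notin> fst ` f ` {..<e}" by blast
  have "fst (f m) \<noteq> fst (f n)" if "m < n" for m n
    using f(2)[of n] that by (metis imageI lessThan_iff)
  then have inj: "inj (\<lambda>e. fst (f e))" by (metis (no_types, lifting) injI linorder_neqE_nat)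
  \<comment> \<open>At indices that are never picked, an arbitrary member of \<open>X i\<close>
    completes the transversal.\<close>
  define x where "x = (\<lambda>i\<in>I. if \<exists>e. fst (f e) = i then snd (f (SOME e. fst (f e) = i)) else (SOME A. A \<in> X i))"
  have fI: "fst (f e) \<in> I" "snd (f e) \<in> X (fst (f e))" for e
    using f(1)[of e] T(2)[OF tT[of e]] unfolding partial_transversal_def by auto
  have xf: "x (fst (f e)) = snd (f e)" for e
  proof -
    have "(SOME k. fst (f k) = fst (f e)) = e"
      using inj by (intro some_equality) (auto dest: injD)
    then show ?thesis using fI(1) by (auto simp: x_def)
  qed
  have xX: "x i \<in> X i" if i: "i \<in> I" for i
  proof (cases "\<exists>e. fst (f e) = i")
    case True
    then obtain e where "fst (f e) = i" by blast
    then show ?thesis using xf fI(2) by metis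
  next
    case False
    then show ?thesis using i nonempty[OF i] by (simp add: x_def some_in_eq)
  qed
  have xP: "x \<in> (\<Pi>\<^sub>E i\<in>I. X i)"
    using xX by (auto simp: x_def)
  have "r = \<zero>" if r: "r \<in> carrier R" "\<forall>i\<in>I. r \<in> x i" for r
  proof (rule separatesD[OF T(3), of "\<lambda>\<tau>. f ` {e. t e = \<tau>}"])
    fix \<tau> assume "\<tau> \<in> T"
    from from_nat_into_surj[OF T(1) this] obtain n where n: "from_nat_into T n = \<tau>" by blast
    show "f ` {e. t e = \<tau>} \<subseteq> \<tau>" using f(1) by auto
    have "range (\<lambda>m. prod_encode (n, m)) \<subseteq> {e. t e = \<tau>}" using n by (auto simp: t_def)
    moreover have "inj (\<lambda>m. prod_encode (n, m))" by (auto simp: inj_def)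
    ultimately have "infinite {e. t e = \<tau>}"
      by (meson finite_imageD finite_subset infinite_UNIV_nat)
    moreover have "inj_on f {e. t e = \<tau>}" using inj by (auto simp: inj_on_def inj_def)
    ultimately show "infinite (f ` {e. t e = \<tau>})" using finite_imageD by blast
    show "r \<in> A" if iA: "(i, A) \<in> f ` {e. t e = \<tau>}" for i A
    proof -
      obtain e where "f e = (i, A)" using iA by (elim imageE) simp
      then show ?thesis using r(2) xf[of e] fI(1)[of e] by auto
    qed
  qed (rule r(1))
  then show ?thesis using xP by blast
qed

end

section \<open>Translation to the dual ideal lattice\<close>

theorem corollary13:
  fixes R :: "('a, 'b) ring_scheme" and D :: "'a set"
  assumes "domain R"
    and "subdomain D R"
    and "countably_generated_over R D"
    and "has_krull_dimension TYPE('o) (R\<lparr>carrier := D\<rparr>)"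
    and "weakly_productively_bounded (R\<lparr>carrier := D\<rparr>)"
  shows "uniformly_transversally_bounded TYPE('i) (dual_ideal_lattice R)"
  unfolding uniformly_transversally_bounded_def
proof (intro allI impI)
  fix I :: "'i set" and X
  interpret R: domain R by fact
  let ?L = "dual_ideal_lattice R"
  assume X: "\<forall>i\<in>I. X i \<subseteq> carrier ?L \<and> X i \<noteq> {}"
    and bounded: "\<forall>x\<in>(\<Pi>\<^sub>E i\<in>I. X i). \<Squnion>\<^bsub>?L\<^esub>(x ` I) \<sqsubset>\<^bsub>?L\<^esub> \<top>\<^bsub>?L\<^esub>"
  \<comment> \<open>Joins are intersections and the top is the zero ideal, so lying below the top
    means having a common nonzero element. The bound \<open>r \<in> carrier R\<close> covers empty
    \<A>, whose join is the whole ring.\<close>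
  have sup: "\<Squnion>\<^bsub>?L\<^esub>\<A> \<sqsubset>\<^bsub>?L\<^esub> \<top>\<^bsub>?L\<^esub> \<longleftrightarrow> (\<exists>r\<in>carrier R. r \<noteq> \<zero>\<^bsub>R\<^esub> \<and> (\<forall>A\<in>\<A>. r \<in> A))"
    if \<A>: "\<A> \<subseteq> carrier ?L" for \<A>
  proof -
    have "\<zero>\<^bsub>R\<^esub> \<in> A" if "A \<in> \<A>" for A
    proof -
      have "ideal A R" using \<A> that by auto
      then show ?thesis by (rule additive_subgroup.zero_closed[OF ideal.axioms(1)])
    qed
    then show ?thesis
      unfolding R.sup_dual_ideal_lattice[OF \<A>] R.top_dual_ideal_lattice dual_ideal_lattice_simps
      by blast
  qed
  show "\<exists>J\<subseteq>I. finite (I - J) \<and> \<Squnion>\<^bsub>?L\<^esub>(\<Union>i\<in>J. X i) \<sqsubset>\<^bsub>?L\<^esub> \<top>\<^bsub>?L\<^esub>"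
  proof (rule ccontr)
    assume contra: "\<not> ?thesis"
    interpret unbounded_family R D I X
    proof (intro unbounded_family.intro unbounded_family_axioms.intro)
      show "ideal A R" if "i \<in> I" "A \<in> X i" for i A using X that by auto
      fix r F assume r: "r \<in> carrier R" "r \<noteq> \<zero>\<^bsub>R\<^esub>" and F: "finite (F :: 'i set)"
      \<comment> \<open>\<open>contra\<close> is applied to the cofinite set
        \<open>I - F\<close>.\<close>
      have "finite (I - (I - F))" using F by (auto intro: finite_subset)
      then have "\<not> \<Squnion>\<^bsub>?L\<^esub>(\<Union>i\<in>I - F. X i) \<sqsubset>\<^bsub>?L\<^esub> \<top>\<^bsub>?L\<^esub>"
        using contra by blast
      moreover have "(\<Union>i\<in>I - F. X i) \<subseteq> carrier ?L" using X by blast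
      ultimately show "\<exists>i\<in>I - F. \<exists>A\<in>X i. r \<notin> A" using sup r by blast
    qed (rule assms(1,2))+
    obtain M where M: "countable M" "M \<subseteq> carrier R" "carrier R \<subseteq> (\<Union>ms\<in>lists M. dspan ms)"
      using countable_dspan_cover[OF assms(3)] by blast
    \<comment> \<open>There are only countably many lists over \<open>M\<close>, so the separating
      families of the spans can be pooled.\<close>
    have "countably_separated R I X (\<Union>(dspan ` lists M))"
      using M(1,2) by (intro countably_separated_UN)
        (auto intro!: countably_separated_dspan[OF assms(4,5)])
    then have "countably_separated R I X (carrier R)"
      using M(3) by (rule countably_separated_subset)
    moreover have "X i \<noteq> {}" if "i \<in> I" for i using X that by simp
    ultimately have "\<exists>x\<in>(\<Pi>\<^sub>E i\<in>I. X i). \<forall>r\<in>carrier R. (\<forall>i\<in>I. r \<in> x i) \<longrightarrow> r = \<zero>\<^bsub>R\<^esub>"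
      by (rule unbounded_transversal)
    then obtain x where x: "x \<in> (\<Pi>\<^sub>E i\<in>I. X i)"
        "\<forall>r\<in>carrier R. (\<forall>i\<in>I. r \<in> x i) \<longrightarrow> r = \<zero>\<^bsub>R\<^esub>"
      by (elim bexE) (rule that)
    have "x ` I \<subseteq> carrier ?L" using x(1) X by blast
    moreover have "\<Squnion>\<^bsub>?L\<^esub>(x ` I) \<sqsubset>\<^bsub>?L\<^esub> \<top>\<^bsub>?L\<^esub>" using bounded x(1) by (rule bspec)
    ultimately have "\<exists>r\<in>carrier R. r \<noteq> \<zero>\<^bsub>R\<^esub> \<and> (\<forall>A\<in>x ` I. r \<in> A)" by (simp only: sup)
    then obtain r where "r \<in> carrier R" "r \<noteq> \<zero>\<^bsub>R\<^esub>" "\<forall>A\<in>x ` I. r \<in> A"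
      by (elim bexE conjE) (rule that)
    then show False using bspec[OF x(2), of r] by simp
  qed
qed

end
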